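(* In the setting of the context, let $$\mathbf X=\begin{bmatrix}\mathbb 1_{n_x}\\ X\end{bmatrix}=(I+\boldsymbol{\mathcal B}K)(\boldsymbol{\mathcal A}\mathbf X_0+\boldsymbol{\mathcal D}W),\qquad U=K(\boldsymbol{\mathcal A}\mathbf X_0+\boldsymbol{\mathcal D}W),$$ where $\mathbf X_0=[\mathbb 1_{n_x}^\top,x_0^\top]^\top$ has mean and covariance $$\boldsymbol\mu_0=\begin{bmatrix}\mathbb 1_{n_x}\\ \mu_0\end{bmatrix},\qquad \mathbf\Sigma_0=\begin{bmatrix}0&0\\0&\Sigma_0\end{bmatrix}\succeq0 .$$ Then the objective function $J=\mathbb E\left[X^\top\bar QX+U^\top\bar RU\right]$ takes the form $$J(K)=\mathrm{tr}\Big(\big((I+\boldsymbol{\mathcal B}K)^\top\bar{\boldsymbol Q}(I+\boldsymbol{\mathcal B}K)+K^\top\bar RK\big)\big(\boldsymbol{\mathcal A}(\boldsymbol\mu_0\boldsymbol\mu_0^\top+\mathbf\Sigma_0)\boldsymbol{\mathcal A}^\top+\boldsymbol{\mathcal D}\boldsymbol{\mathcal D}^\top\big)\Big),$$ which is a quadratic expression in (the entries of) $K$.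
   Context: Fix positive integers $N,n_x,n_u,n_w$ and real matrices $A_k\in\mathbb R^{n_x\times n_x}$, $B_k\in\mathbb R^{n_x\times n_u}$, $D_k\in\mathbb R^{n_x\times n_w}$, $k=0,\dots,N-1$ (the data of the linear system $x_{k+1}=A_kx_k+B_ku_k+D_kw_k$). Define $\mathcal A\in\mathbb R^{(N+1)n_x\times n_x}$, $\mathcal B\in\mathbb R^{(N+1)n_x\times Nn_u}$, $\mathcal D\in\mathbb R^{(N+1)n_x\times Nn_w}$ blockwise, with block rows $i=0,\dots,N$ and block columns $j=0,\dots,N-1$: the $i$-th block of $\mathcal A$ is $A_{i-1}A_{i-2}\cdots A_0$ (and $I_{n_x}$ for $i=0$); the $(i,j)$ block of $\mathcal B$ is $A_{i-1}A_{i-2}\cdots A_{j+1}B_j$ if $j<i$ (equal to $B_{i-1}$ if $j=i-1$) and $0$ if $j\ge i$; $\mathcal D$ is defined likewise with $D_j$ in place of $B_j$. So the system reads $X=\mathcal Ax_0+\mathcal BU+\mathcal DW$, with $X,U,W$ the stacked states $x_0,\dots,x_N$, inputs $u_0,\dots,u_{N-1}$ and noises $w_0,\dots,w_{N-1}$. Augmented matrices: $\boldsymbol{\mathcal A}=\mathrm{blkdiag}(I_{n_x},\mathcal A)\in\mathbb R^{(N+2)n_x\times 2n_x}$, $\boldsymbol{\mathcal B}=\begin{bmatrix}0\\ \mathcal B\end{bmatrix}\in\mathbb R^{(N+2)n_x\times Nn_u}$, $\boldsymbol{\mathcal D}=\begin{bmatrix}0\\ \mathcal D\end{bmatrix}\in\mathbb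 R^{(N+2)n_x\times Nn_w}$, where the zero blocks have $n_x$ rows. Randomness: $x_0\sim\mathcal N(\mu_0,\Sigma_0)$ with $\Sigma_0\succeq0$; $W$ is Gaussian with $\mathbb E[W]=0$, $\mathbb E[WW^\top]=I_{Nn_w}$ and $\mathbb E[x_0W^\top]=0$. $\mathbb 1_{n_x}$ is the all-ones vector. Weights: $Q_k\succeq0$ ($n_x\times n_x$) and $R_k\succ0$ ($n_u\times n_u$) symmetric, $k=0,\dots,N-1$; $\bar Q=\mathrm{blkdiag}(Q_0,\dots,Q_{N-1},0)\in\mathbb R^{(N+1)n_x\times(N+1)n_x}$, $\bar R=\mathrm{blkdiag}(R_0,\dots,R_{N-1})$, and $\bar{\boldsymbol Q}=\mathrm{blkdiag}(0_{n_x},\bar Q)\in\mathbb R^{(N+2)n_x\times(N+2)n_x}$. Gain: $K=L(I-\boldsymbol{\mathcal B}L)^{-1}\in\mathbb R^{Nn_u\times(N+2)n_x}$, where $L=[L_{\mathbb 1},L_X]$ with $L_{\mathbb 1}\in\mathbb R^{Nn_u\times n_x}$ and $L_X\in\mathbb R^{Nn_u\times(N+1)n_x}$ lower block triangular (blocks of size $n_u\times n_x$; block $(i,j)$ is zero for $j>i$); $I-\boldsymbol{\mathcal B}L$ is then invertible. *)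

theory Defs
  imports
    "HOL-Probability.Probability"
    "Jordan_Normal_Form.Matrix"
    "Jordan_Normal_Form.Gauss_Jordan_Elimination"
begin

(* The symbols for indexing and for the scalar product refer to vectors and matrices
   of Jordan_Normal_Form, whose dimensions are natural numbers. *)
unbundle no vec_syntax
unbundle no inner_syntax


section \<open>Matrices\<close>

definition mat_trace :: "real mat \<Rightarrow> real" where
  "mat_trace A = (\<Sum>i<dim_row A. A $$ (i, i))"

definition psd_mat :: "nat \<Rightarrow> real mat \<Rightarrow> bool" where
  "psd_mat n A \<longleftrightarrow> A \<in> carrier_mat n n \<and> A\<^sup>T = A \<and>
     (\<forall>v\<in>carrier_vec n. 0 \<le> v \<bullet> (A *\<^sub>v v))"

definition pd_mat :: "nat \<Rightarrow> real mat \<Rightarrow> bool" where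
  "pd_mat n A \<longleftrightarrow> A \<in> carrier_mat n n \<and> A\<^sup>T = A \<and>
     (\<forall>v\<in>carrier_vec n. v \<noteq> 0\<^sub>v n \<longrightarrow> 0 < v \<bullet> (A *\<^sub>v v))"

definition ones_vec :: "nat \<Rightarrow> real vec" where
  "ones_vec n = vec n (\<lambda>_. 1)"

definition outer_prod :: "real vec \<Rightarrow> real vec \<Rightarrow> real mat" where
  "outer_prod v w = mat (dim_vec v) (dim_vec w) (\<lambda>(i, j). v $ i * w $ j)"

definition append_cols :: "real mat \<Rightarrow> real mat \<Rightarrow> real mat" where
  "append_cols A B = four_block_mat A B (0\<^sub>m 0 (dim_col A)) (0\<^sub>m 0 (dim_col B))"

text \<open>The matrix with \<open>m\<close> block rows and \<open>n\<close> block columns whose block \<open>(i, j)\<close> is the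
  \<open>p \<times> q\<close> matrix \<open>F i j\<close>.\<close>

definition block_mat :: "nat \<Rightarrow> nat \<Rightarrow> nat \<Rightarrow> nat \<Rightarrow> (nat \<Rightarrow> nat \<Rightarrow> real mat) \<Rightarrow> real mat" where
  "block_mat m n p q F =
     mat (m * p) (n * q) (\<lambda>(r, c). F (r div p) (c div q) $$ (r mod p, c mod q))"

text \<open>Block \<open>(i, j)\<close>, of size \<open>p \<times> q\<close>, vanishes for \<open>j > i\<close>; the matrix need not be square.\<close>

definition block_lower_triangular :: "nat \<Rightarrow> nat \<Rightarrow> real mat \<Rightarrow> bool" where
  "block_lower_triangular p q A \<longleftrightarrow>
     (\<forall>r<dim_row A. \<forall>c<dim_col A. r div p < c div q \<longrightarrow> A $$ (r, c) = 0)"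

text \<open>\<open>f\<close> agrees on the \<open>m \<times> n\<close> matrices with a polynomial of total degree exactly two in the
  entries: the homogeneous part of degree two is not identically zero.\<close>

definition quadratic_in_entries :: "nat \<Rightarrow> nat \<Rightarrow> (real mat \<Rightarrow> real) \<Rightarrow> bool" where
  "quadratic_in_entries m n f \<longleftrightarrow>
     (\<exists>(c :: real) (l :: nat \<Rightarrow> nat \<Rightarrow> real) (q :: nat \<Rightarrow> nat \<Rightarrow> nat \<Rightarrow> nat \<Rightarrow> real).
        (\<forall>K\<in>carrier_mat m n.
           f K = c + (\<Sum>i<m. \<Sum>j<n. l i j * K $$ (i, j))
                 + (\<Sum>i<m. \<Sum>j<n. \<Sum>i'<m. \<Sum>j'<n. q i j i' j' * K $$ (i, j) * K $$ (i', j'))) \<and>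
        (\<exists>K\<in>carrier_mat m n.
           (\<Sum>i<m. \<Sum>j<n. \<Sum>i'<m. \<Sum>j'<n. q i j i' j' * K $$ (i, j) * K $$ (i', j')) \<noteq> 0))"


section \<open>Stacked system matrices\<close>

text \<open>\<open>transition n A j d\<close> is the product \<open>A (j + d - 1) * \<dots> * A (j + 1) * A j\<close> of \<open>d\<close> factors.\<close>

primrec transition :: "nat \<Rightarrow> (nat \<Rightarrow> real mat) \<Rightarrow> nat \<Rightarrow> nat \<Rightarrow> real mat" where
  "transition n A j 0 = 1\<^sub>m n"
| "transition n A j (Suc d) = A (j + d) * transition n A j d"

definition stacked_state_mat :: "nat \<Rightarrow> nat \<Rightarrow> (nat \<Rightarrow> real mat) \<Rightarrow> real mat" where
  "stacked_state_mat N n A = block_mat (N + 1) 1 n n (\<lambda>i _. transition n A 0 i)"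

text \<open>The following serves for the inputs as well as for the noises.\<close>

definition stacked_input_mat ::
    "nat \<Rightarrow> nat \<Rightarrow> nat \<Rightarrow> (nat \<Rightarrow> real mat) \<Rightarrow> (nat \<Rightarrow> real mat) \<Rightarrow> real mat" where
  "stacked_input_mat N n m A B = block_mat (N + 1) N n m
     (\<lambda>i j. if j < i then transition n A (j + 1) (i - j - 1) * B j else 0\<^sub>m n m)"

definition augmented_state_mat :: "nat \<Rightarrow> nat \<Rightarrow> (nat \<Rightarrow> real mat) \<Rightarrow> real mat" where
  "augmented_state_mat N n A = diag_block_mat [1\<^sub>m n, stacked_state_mat N n A]"

definition augmented_input_mat ::
    "nat \<Rightarrow> nat \<Rightarrow> nat \<Rightarrow> (nat \<Rightarrow> real mat) \<Rightarrow> (nat \<Rightarrow> real mat) \<Rightarrow> real mat" where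
  "augmented_input_mat N n m A B = 0\<^sub>m n (N * m) @\<^sub>r stacked_input_mat N n m A B"

definition state_weight :: "nat \<Rightarrow> nat \<Rightarrow> (nat \<Rightarrow> real mat) \<Rightarrow> real mat" where
  "state_weight N n Q = diag_block_mat (map Q [0..<N] @ [0\<^sub>m n n])"

definition input_weight :: "nat \<Rightarrow> (nat \<Rightarrow> real mat) \<Rightarrow> real mat" where
  "input_weight N R = diag_block_mat (map R [0..<N])"


section \<open>Random vectors\<close>

definition random_vec :: "'a measure \<Rightarrow> nat \<Rightarrow> ('a \<Rightarrow> real vec) \<Rightarrow> bool" where
  "random_vec M n Z \<longleftrightarrow> (\<forall>\<omega>\<in>space M. Z \<omega> \<in> carrier_vec n) \<and>
     (\<forall>i<n. (\<lambda>\<omega>. Z \<omega> $ i) \<in> borel_measurable M)"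

definition mean_vec :: "'a measure \<Rightarrow> nat \<Rightarrow> ('a \<Rightarrow> real vec) \<Rightarrow> real vec" where
  "mean_vec M n Z = vec n (\<lambda>i. \<integral>\<omega>. Z \<omega> $ i \<partial>M)"

definition mean_mat :: "'a measure \<Rightarrow> nat \<Rightarrow> nat \<Rightarrow> ('a \<Rightarrow> real mat) \<Rightarrow> real mat" where
  "mean_mat M m n F = mat m n (\<lambda>(i, j). \<integral>\<omega>. F \<omega> $$ (i, j) \<partial>M)"

definition covariance_mat :: "'a measure \<Rightarrow> nat \<Rightarrow> ('a \<Rightarrow> real vec) \<Rightarrow> real mat" where
  "covariance_mat M n Z =
     mean_mat M n n (\<lambda>\<omega>. outer_prod (Z \<omega> - mean_vec M n Z) (Z \<omega> - mean_vec M n Z))"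

text \<open>The real normal distribution with mean \<open>m\<close> and variance \<open>v \<ge> 0\<close>, a point mass if \<open>v = 0\<close>.
  Note that \<open>normal_density\<close> takes the standard deviation.\<close>

definition normal_law :: "real \<Rightarrow> real \<Rightarrow> real measure" where
  "normal_law m v =
     (if v = 0 then return borel m else density lborel (\<lambda>x. ennreal (normal_density m (sqrt v) x)))"

text \<open>The possibly degenerate multivariate normal distribution: every linear functional of the
  vector is normally distributed with the matching mean and variance.\<close>

definition normal_vec ::
    "'a measure \<Rightarrow> nat \<Rightarrow> ('a \<Rightarrow> real vec) \<Rightarrow> real vec \<Rightarrow> real mat \<Rightarrow> bool" where
  "normal_vec M n Z \<mu> \<Sigma> \<longleftrightarrow> random_vec M n Z \<and> \<mu> \<in> carrier_vec n \<and> psd_mat n \<Sigma> \<and>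
     (\<forall>t\<in>carrier_vec n. distr M borel (\<lambda>\<omega>. t \<bullet> Z \<omega>) = normal_law (t \<bullet> \<mu>) (t \<bullet> (\<Sigma> *\<^sub>v t)))"

definition gaussian_vec :: "'a measure \<Rightarrow> nat \<Rightarrow> ('a \<Rightarrow> real vec) \<Rightarrow> bool" where
  "gaussian_vec M n Z \<longleftrightarrow> (\<exists>\<mu> \<Sigma>. normal_vec M n Z \<mu> \<Sigma>)"

end

theory Submission
  imports Defs "Jordan_Normal_Form.Determinant"
begin

text \<open>With \<open>z = \<A> X\<^sub>0 + \<D> W\<close>, the cost is \<open>z\<^sup>T H z\<close> for
  \<open>H = (I + \<B> K)\<^sup>T Q (I + \<B> K) + K\<^sup>T R K\<close>, since the weight of the constant part of the
  augmented state is zero. Its expectation is \<open>tr (H S)\<close> with \<open>S = E (z z\<^sup>T)\<close>, and the cross terms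
  of \<open>S\<close> vanish because \<open>W\<close> is centred and uncorrelated with \<open>x\<^sub>0\<close>. As a polynomial in \<open>K\<close> the
  homogeneous part of degree two is \<open>tr (K\<^sup>T P K S)\<close> with \<open>P = \<B>\<^sup>T Q \<B> + R\<close>; at the matrix unit
  \<open>K = E\<^sub>0\<^sub>0\<close> it equals \<open>P\<^sub>0\<^sub>0 S\<^sub>0\<^sub>0 = P\<^sub>0\<^sub>0 > 0\<close>.\<close>

section \<open>Moments of normal vectors\<close>

text \<open>Two features of the definitions shape the route. Normality is encoded by the laws of
  scalar functionals, so mixed moments of coordinates have to be recovered from second moments of
  functionals. And \<open>mean_mat\<close> consists of Bochner integrals, which are 0 for
  non-integrable functions: an equation with value 0, such as the one for \<open>x0\<close> and
  \<open>W\<close>, says nothing about integrability by itself. Integrability comes from the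
  normality of \<open>x0\<close> and of \<open>W\<close> separately, since no joint law is given;
  all expectations are therefore carried as \<open>has_bochner_integral\<close>. The block
  triangular shape of \<open>LX\<close> enters through the determinant of \<open>1 - BB * L\<close>,
  which is 1; the inverse then exists and \<open>K\<close> has the expected dimensions. The entry
  (0, 0) of \<open>K\<close> is the gain from the first constant coordinate to the first input. This
  makes it a good test point: the corresponding entry of \<open>S\<close> is 1 for every
  \<open>\<Sigma>0\<close> and \<open>D\<close>, even when both vanish, while the entry of
  \<open>P\<close> is strictly positive because of \<open>R 0\<close>, whatever the state weights
  add.\<close>

lemma normal_law_moments:
  assumes "0 \<le> v"
  shows "has_bochner_integral (normal_law m v) (\<lambda>x. x) m"
    and "has_bochner_integral (normal_law m v) (\<lambda>x. x\<^sup>2) (v + m\<^sup>2)"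
proof -
  have "has_bochner_integral (normal_law m v) (\<lambda>x. x) m \<and>
    has_bochner_integral (normal_law m v) (\<lambda>x. x\<^sup>2) (v + m\<^sup>2)"
  proof (cases "v = 0")
    case True
    interpret prob_space "return borel m" by (rule prob_space_return) simp
    have dirac: "has_bochner_integral (return borel m) f (f m)"
      if [measurable]: "f \<in> borel_measurable borel"
      for f :: "real \<Rightarrow> real"
    proof -
      have "has_bochner_integral (return borel m) (\<lambda>_. f m) (f m)"
        using prob_space by (simp add: has_bochner_integral_iff)
      moreover have f: "f \<in> borel_measurable (return borel m)"
        using that by (simp add: measurable_def)
      moreover have "AE x in return borel m. f x = f m"
        by (subst AE_return) auto
      ultimately show ?thesis
        using has_bochner_integral_cong_AE[OF f borel_measurable_const, of "f m" "f m"] by blast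
    qed
    have "has_bochner_integral (return borel m) (\<lambda>x. x) m"
      by (rule dirac) simp
    moreover have "has_bochner_integral (return borel m) (\<lambda>x. x\<^sup>2) (m\<^sup>2)"
      by (rule dirac) simp
    ultimately show ?thesis
      unfolding normal_law_def True by simp
  next
    case False
    with assms have s: "0 < sqrt v" and v: "(sqrt v)\<^sup>2 = v" by simp_all
    let ?d = "normal_density m (sqrt v)"
    have 0: "has_bochner_integral lborel ?d 1"
      using normal_moment_even[OF s, of m 0] by simp
    have 1: "has_bochner_integral lborel (\<lambda>x. ?d x * x) m"
      by (rule normal_moment_nz_1[OF s])
    have "has_bochner_integral lborel (\<lambda>x. ?d x * (x - m)\<^sup>2) v"
      using normal_moment_even[OF s, of m 1] v by simp
    \<comment> \<open>The raw second moment is assembled from the moments above by x^2 = (x - m)^2 +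
      2 m x - m^2.\<close>
    from has_bochner_integral_add[OF this has_bochner_integral_add
        [OF has_bochner_integral_mult_right[OF 1, of "2 * m"]
          has_bochner_integral_mult_right[OF 0, of "- m\<^sup>2"]]]
    have 2: "has_bochner_integral lborel (\<lambda>x. ?d x * x\<^sup>2) (v + m\<^sup>2)"
      by (simp add: power2_eq_square algebra_simps)
    show ?thesis using 1 2 False
      by (simp add: normal_law_def has_bochner_integral_iff integrable_density integral_density
          normal_density_nonneg)
  qed
  then show "has_bochner_integral (normal_law m v) (\<lambda>x. x) m"
    and "has_bochner_integral (normal_law m v) (\<lambda>x. x\<^sup>2) (v + m\<^sup>2)" by auto
qed

lemma scalar_prod_measurable:
  assumes "random_vec M n Z" "t \<in> carrier_vec n"
  shows "(\<lambda>\<omega>. t \<bullet> Z \<omega>) \<in> borel_measurable M"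
proof -
  have "(\<lambda>\<omega>. \<Sum>i<n. t $ i * Z \<omega> $ i) \<in> borel_measurable M"
  proof (rule borel_measurable_sum)
    fix i assume "i \<in> {..<n}"
    with assms have [measurable]: "(\<lambda>\<omega>. Z \<omega> $ i) \<in> borel_measurable M"
      by (simp add: random_vec_def)
    show "(\<lambda>\<omega>. t $ i * Z \<omega> $ i) \<in> borel_measurable M" by measurable
  qed
  \<comment> \<open>\<open>scalar_prod\<close> sums up to the dimension of its second argument,
    which is known to be \<open>n\<close> only on the space of \<open>M\<close>; measurability looks
    no further.\<close>
  moreover have "t \<bullet> Z \<omega> = (\<Sum>i<n. t $ i * Z \<omega> $ i)" if "\<omega> \<in> space M" for \<omega>
  proof -
    have "dim_vec (Z \<omega>) = n"
      using assms(1) that carrier_vecD unfolding random_vec_def by blast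
    then show ?thesis by (simp add: scalar_prod_def atLeast0LessThan)
  qed
  ultimately show ?thesis
    using measurable_cong[of M "\<lambda>\<omega>. t \<bullet> Z \<omega>" "\<lambda>\<omega>. \<Sum>i<n. t $ i * Z \<omega> $ i" borel] by blast
qed

lemma normal_vec_functional_moments:
  assumes "normal_vec M n Z \<mu> \<Sigma>" "t \<in> carrier_vec n"
  shows "has_bochner_integral M (\<lambda>\<omega>. t \<bullet> Z \<omega>) (t \<bullet> \<mu>)"
    and "has_bochner_integral M (\<lambda>\<omega>. (t \<bullet> Z \<omega>)\<^sup>2) (t \<bullet> (\<Sigma> *\<^sub>v t) + (t \<bullet> \<mu>)\<^sup>2)"
proof -
  have m[measurable]: "(\<lambda>\<omega>. t \<bullet> Z \<omega>) \<in> borel_measurable M"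
    using assms by (intro scalar_prod_measurable) (auto simp: normal_vec_def)
  have law: "distr M borel (\<lambda>\<omega>. t \<bullet> Z \<omega>) = normal_law (t \<bullet> \<mu>) (t \<bullet> (\<Sigma> *\<^sub>v t))"
    and nonneg: "0 \<le> t \<bullet> (\<Sigma> *\<^sub>v t)"
    using assms by (auto simp: normal_vec_def psd_mat_def)
  \<comment> \<open>After folding, the moments are those of the pushforward of \<open>M\<close>
    under the functional, and change of variables carries them back to \<open>M\<close>.\<close>
  note moments = normal_law_moments[OF nonneg, of "t \<bullet> \<mu>", folded law]
  show "has_bochner_integral M (\<lambda>\<omega>. t \<bullet> Z \<omega>) (t \<bullet> \<mu>)"
    using moments(1) unfolding has_bochner_integral_iff by (simp add: integrable_distr_eq integral_distr)
  show "has_bochner_integral M (\<lambda>\<omega>. (t \<bullet> Z \<omega>)\<^sup>2) (t \<bullet> (\<Sigma> *\<^sub>v t) + (t \<bullet> \<mu>)\<^sup>2)"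
    using moments(2) unfolding has_bochner_integral_iff by (simp add: integrable_distr_eq integral_distr)
qed

lemma normal_vec_mean:
  assumes "normal_vec M n Z \<mu> \<Sigma>" "i < n"
  shows "has_bochner_integral M (\<lambda>\<omega>. Z \<omega> $ i) (\<mu> $ i)"
proof -
  have "unit_vec n i \<bullet> Z \<omega> = Z \<omega> $ i" if "\<omega> \<in> space M" for \<omega>
    using assms that by (intro scalar_prod_left_unit) (auto simp: normal_vec_def random_vec_def)
  moreover have "unit_vec n i \<bullet> \<mu> = \<mu> $ i"
    using assms by (intro scalar_prod_left_unit) (auto simp: normal_vec_def)
  ultimately show ?thesis
    using normal_vec_functional_moments(1)[OF assms(1) unit_vec_carrier, of i]
      has_bochner_integral_cong[OF refl _ refl, of M "\<lambda>\<omega>. unit_vec n i \<bullet> Z \<omega>" "\<lambda>\<omega>. Z \<omega> $ i"]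
    by metis
qed

lemma normal_vec_second_moment:
  assumes Z: "normal_vec M n Z \<mu> \<Sigma>" and i: "i < n" and j: "j < n"
  shows "has_bochner_integral M (\<lambda>\<omega>. Z \<omega> $ i * Z \<omega> $ j) (\<Sigma> $$ (i, j) + \<mu> $ i * \<mu> $ j)"
proof -
  have Zcar: "Z \<omega> \<in> carrier_vec n" if "\<omega> \<in> space M" for \<omega>
    using Z that by (auto simp: normal_vec_def random_vec_def)
  have car: "\<mu> \<in> carrier_vec n" "\<Sigma> \<in> carrier_mat n n" and sym: "\<Sigma>\<^sup>T = \<Sigma>"
    using Z by (auto simp: normal_vec_def psd_mat_def)
  txt \<open>Polarization: the second moment of the functional \<open>e i + e j\<close> yields the mixed moment.\<close>
  define e where "e = (unit_vec n :: nat \<Rightarrow> real vec)"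
  have e: "e k \<in> carrier_vec n" for k by (simp add: e_def)
  have ev: "e k \<bullet> v = v $ k" if "k < n" "v \<in> carrier_vec n" for k and v :: "real vec"
    using that by (simp add: e_def)
  have eSe: "e k \<bullet> (\<Sigma> *\<^sub>v e l) = \<Sigma> $$ (k, l)" if "k < n" "l < n" for k l
    using that car by (simp add: e_def)
  have sum: "(e i + e j) \<bullet> v = v $ i + v $ j" if "v \<in> carrier_vec n" for v
    using that i j by (simp add: add_scalar_prod_distrib[OF e e] ev)
  have "(e i + e j) \<bullet> (\<Sigma> *\<^sub>v (e i + e j))
      = \<Sigma> $$ (i, i) + \<Sigma> $$ (i, j) + (\<Sigma> $$ (j, i) + \<Sigma> $$ (j, j))"
  proof -
    have "\<Sigma> *\<^sub>v (e i + e j) = \<Sigma> *\<^sub>v e i + \<Sigma> *\<^sub>v e j"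
      by (rule mult_add_distrib_mat_vec[OF car(2) e e])
    moreover have c: "\<Sigma> *\<^sub>v e k \<in> carrier_vec n" for k
      using car e by (intro mult_mat_vec_carrier) auto
    ultimately show ?thesis
      using i j by (simp add: add_scalar_prod_distrib[OF e e] scalar_prod_add_distrib[OF e] eSe c)
  qed
  moreover have "\<Sigma> $$ (j, i) = \<Sigma> $$ (i, j)"
    using car i j arg_cong[OF sym, of "\<lambda>A. A $$ (i, j)"] by simp
  ultimately have "has_bochner_integral M (\<lambda>\<omega>. ((e i + e j) \<bullet> Z \<omega>)\<^sup>2)
      (\<Sigma> $$ (i, i) + 2 * \<Sigma> $$ (i, j) + \<Sigma> $$ (j, j) + (\<mu> $ i + \<mu> $ j)\<^sup>2)"
    using normal_vec_functional_moments(2)[OF Z, of "e i + e j"] e sum[OF car(1)]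
    by (simp add: algebra_simps)
  moreover have "has_bochner_integral M (\<lambda>\<omega>. (e k \<bullet> Z \<omega>)\<^sup>2) (\<Sigma> $$ (k, k) + (\<mu> $ k)\<^sup>2)"
    if "k < n" for k
    using normal_vec_functional_moments(2)[OF Z e, of k] that eSe ev car(1) by simp
  note this[OF i] this[OF j]
  ultimately have "has_bochner_integral M
      (\<lambda>\<omega>. (((e i + e j) \<bullet> Z \<omega>)\<^sup>2 - ((e i \<bullet> Z \<omega>)\<^sup>2 + (e j \<bullet> Z \<omega>)\<^sup>2)) / 2)
      ((\<Sigma> $$ (i, i) + 2 * \<Sigma> $$ (i, j) + \<Sigma> $$ (j, j) + (\<mu> $ i + \<mu> $ j)\<^sup>2
        - (\<Sigma> $$ (i, i) + (\<mu> $ i)\<^sup>2 + (\<Sigma> $$ (j, j) + (\<mu> $ j)\<^sup>2))) / 2)"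
    by (intro has_bochner_integral_divide_zero has_bochner_integral_diff has_bochner_integral_add)
  moreover have "(((e i + e j) \<bullet> Z \<omega>)\<^sup>2 - ((e i \<bullet> Z \<omega>)\<^sup>2 + (e j \<bullet> Z \<omega>)\<^sup>2)) / 2 = Z \<omega> $ i * Z \<omega> $ j"
    if "\<omega> \<in> space M" for \<omega>
    using Zcar[OF that] i j by (simp add: sum ev power2_eq_square algebra_simps)
  then have "has_bochner_integral M (\<lambda>\<omega>. Z \<omega> $ i * Z \<omega> $ j)
      ((\<Sigma> $$ (i, i) + 2 * \<Sigma> $$ (i, j) + \<Sigma> $$ (j, j) + (\<mu> $ i + \<mu> $ j)\<^sup>2
        - (\<Sigma> $$ (i, i) + (\<mu> $ i)\<^sup>2 + (\<Sigma> $$ (j, j) + (\<mu> $ j)\<^sup>2))) / 2)"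
    using calculation by (rule has_bochner_integral_cong[OF refl _ refl, THEN iffD1])
  moreover have "(\<Sigma> $$ (i, i) + 2 * \<Sigma> $$ (i, j) + \<Sigma> $$ (j, j) + (\<mu> $ i + \<mu> $ j)\<^sup>2
        - (\<Sigma> $$ (i, i) + (\<mu> $ i)\<^sup>2 + (\<Sigma> $$ (j, j) + (\<mu> $ j)\<^sup>2))) / 2
      = \<Sigma> $$ (i, j) + \<mu> $ i * \<mu> $ j"
    by (simp add: power2_eq_square field_simps)
  ultimately show ?thesis by (simp only:)
qed

section \<open>Means of random matrices\<close>

lemma dim_outer_prod [simp]:
  "dim_row (outer_prod v w) = dim_vec v" "dim_col (outer_prod v w) = dim_vec w"
  by (simp_all add: outer_prod_def)

lemma index_outer_prod [simp]:
  "i < dim_vec v \<Longrightarrow> j < dim_vec w \<Longrightarrow> outer_prod v w $$ (i, j) = v $ i * w $ j"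
  by (simp add: outer_prod_def)

lemma outer_prod_carrier [simp]:
  "v \<in> carrier_vec m \<Longrightarrow> w \<in> carrier_vec n \<Longrightarrow> outer_prod v w \<in> carrier_mat m n"
  by (intro carrier_matI) (simp_all add: carrier_vecD)

lemma transpose_outer_prod: "(outer_prod v w)\<^sup>T = outer_prod w v"
  by (rule eq_matI) (simp_all add: mult.commute)

lemma outer_prod_add_left:
  "v \<in> carrier_vec n \<Longrightarrow> v' \<in> carrier_vec n \<Longrightarrow>
    outer_prod (v + v') w = outer_prod v w + outer_prod v' w"
  by (rule eq_matI) (simp_all add: distrib_right)

lemma outer_prod_add_right:
  "w \<in> carrier_vec n \<Longrightarrow> w' \<in> carrier_vec n \<Longrightarrow>
    outer_prod v (w + w') = outer_prod v w + outer_prod v w'"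
  by (rule eq_matI) (simp_all add: distrib_left)

lemma outer_prod_mult_left:
  assumes "A \<in> carrier_mat m n" "v \<in> carrier_vec n"
  shows "outer_prod (A *\<^sub>v v) w = A * outer_prod v w"
  using assms by (intro eq_matI) (auto simp: scalar_prod_def sum_distrib_right mult.assoc)

lemma outer_prod_mult_right:
  assumes "A \<in> carrier_mat m n" "w \<in> carrier_vec n"
  shows "outer_prod v (A *\<^sub>v w) = outer_prod v w * A\<^sup>T"
  using assms by (intro eq_matI) (auto simp: scalar_prod_def sum_distrib_left ac_simps)

lemma mat_trace_mult:
  assumes "A \<in> carrier_mat m n" "B \<in> carrier_mat n m"
  shows "mat_trace (A * B) = (\<Sum>i<m. \<Sum>j<n. A $$ (i, j) * B $$ (j, i))"
  using assms by (simp add: mat_trace_def scalar_prod_def atLeast0LessThan)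

lemma mat_trace_add:
  "A \<in> carrier_mat n n \<Longrightarrow> B \<in> carrier_mat n n \<Longrightarrow> mat_trace (A + B) = mat_trace A + mat_trace B"
  by (simp add: mat_trace_def sum.distrib)

text \<open>Cyclicity of the trace for a rank one factor. For \<open>v = w\<close> it replaces a
  quadratic form by an expression linear in the outer product, through which the expectation
  passes.\<close>

lemma mat_trace_mult_outer_prod:
  assumes "A \<in> carrier_mat m n" "v \<in> carrier_vec n" "w \<in> carrier_vec m"
  shows "mat_trace (A * outer_prod v w) = w \<bullet> (A *\<^sub>v v)"
  using assms by (simp add: mat_trace_mult[of _ m n])
    (simp add: scalar_prod_def atLeast0LessThan sum_distrib_left ac_simps)

text \<open>Unlike an equation for \<open>mean_mat\<close>, this relation records the integrability
  of every entry, so that the linearity rules below need no side conditions on integrals.\<close>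

definition has_mean_mat :: "'a measure \<Rightarrow> nat \<Rightarrow> nat \<Rightarrow> ('a \<Rightarrow> real mat) \<Rightarrow> real mat \<Rightarrow> bool" where
  "has_mean_mat M m n F C \<longleftrightarrow> C \<in> carrier_mat m n \<and> (\<forall>\<omega>\<in>space M. F \<omega> \<in> carrier_mat m n) \<and>
     (\<forall>i<m. \<forall>j<n. has_bochner_integral M (\<lambda>\<omega>. F \<omega> $$ (i, j)) (C $$ (i, j)))"

lemma has_mean_matD:
  assumes "has_mean_mat M m n F C"
  shows "C \<in> carrier_mat m n" "\<omega> \<in> space M \<Longrightarrow> F \<omega> \<in> carrier_mat m n"
    and "i < m \<Longrightarrow> j < n \<Longrightarrow> has_bochner_integral M (\<lambda>\<omega>. F \<omega> $$ (i, j)) (C $$ (i, j))"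
  using assms unfolding has_mean_mat_def by blast+

text \<open>The family \<open>f\<close> allows a convenient closed form of each entry. It has to
  match \<open>F\<close> only on the space of \<open>M\<close>, where the dimensions of the random
  vectors are known.\<close>

lemma has_mean_matI:
  assumes "C \<in> carrier_mat m n" "\<And>\<omega>. \<omega> \<in> space M \<Longrightarrow> F \<omega> \<in> carrier_mat m n"
    and "\<And>i j. i < m \<Longrightarrow> j < n \<Longrightarrow> has_bochner_integral M (f i j) (C $$ (i, j))"
    and "\<And>i j \<omega>. i < m \<Longrightarrow> j < n \<Longrightarrow> \<omega> \<in> space M \<Longrightarrow> F \<omega> $$ (i, j) = f i j \<omega>"
  shows "has_mean_mat M m n F C"
  unfolding has_mean_mat_def
proof (intro conjI ballI allI impI)
  fix i j assume ij: "i < m" "j < n"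
  show "has_bochner_integral M (\<lambda>\<omega>. F \<omega> $$ (i, j)) (C $$ (i, j))"
    using assms(3)[OF ij] assms(4)[OF ij]
    by (rule has_bochner_integral_cong[OF refl _ refl, THEN iffD2, rotated])
qed (use assms in auto)

lemma mean_mat_eq:
  assumes "has_mean_mat M m n F C"
  shows "mean_mat M m n F = C"
proof (rule eq_matI)
  show "mean_mat M m n F $$ (i, j) = C $$ (i, j)" if "i < dim_row C" "j < dim_col C" for i j
    using has_mean_matD(1)[OF assms] has_mean_matD(3)[OF assms, of i j] that
    by (simp add: mean_mat_def has_bochner_integral_integral_eq)
qed (use has_mean_matD(1)[OF assms] in \<open>simp_all add: mean_mat_def\<close>)

lemma has_mean_mat_cong:
  assumes "has_mean_mat M m n F C" "\<And>\<omega>. \<omega> \<in> space M \<Longrightarrow> F \<omega> = G \<omega>"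
  shows "has_mean_mat M m n G C"
proof (rule has_mean_matI[OF has_mean_matD(1)[OF assms(1)]])
  show "G \<omega> \<in> carrier_mat m n" if "\<omega> \<in> space M" for \<omega>
    using has_mean_matD(2)[OF assms(1) that] assms(2)[OF that] by simp
  show "has_bochner_integral M (\<lambda>\<omega>. F \<omega> $$ (i, j)) (C $$ (i, j))" if "i < m" "j < n" for i j
    using has_mean_matD(3)[OF assms(1) that] .
qed (use assms(2) in simp)

lemma has_mean_mat_add:
  assumes F: "has_mean_mat M m n F C" and G: "has_mean_mat M m n G D"
  shows "has_mean_mat M m n (\<lambda>\<omega>. F \<omega> + G \<omega>) (C + D)"
proof (rule has_mean_matI)
  fix i j assume ij: "i < m" "j < n"
  show "has_bochner_integral M (\<lambda>\<omega>. F \<omega> $$ (i, j) + G \<omega> $$ (i, j)) ((C + D) $$ (i, j))"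
    using has_bochner_integral_add[OF has_mean_matD(3)[OF F ij] has_mean_matD(3)[OF G ij]]
      has_mean_matD(1)[OF F] has_mean_matD(1)[OF G] ij by simp
  show "(F \<omega> + G \<omega>) $$ (i, j) = F \<omega> $$ (i, j) + G \<omega> $$ (i, j)" if "\<omega> \<in> space M" for \<omega>
    using has_mean_matD(2)[OF F that] has_mean_matD(2)[OF G that] ij by simp
qed (use has_mean_matD(1,2)[OF F] has_mean_matD(1,2)[OF G] in auto)

lemma has_mean_mat_transpose:
  assumes F: "has_mean_mat M m n F C"
  shows "has_mean_mat M n m (\<lambda>\<omega>. (F \<omega>)\<^sup>T) C\<^sup>T"
proof (rule has_mean_matI)
  fix i j assume ij: "i < n" "j < m"
  show "has_bochner_integral M (\<lambda>\<omega>. F \<omega> $$ (j, i)) (C\<^sup>T $$ (i, j))"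
    using has_mean_matD(3)[OF F ij(2,1)] has_mean_matD(1)[OF F] ij by simp
  show "(F \<omega>)\<^sup>T $$ (i, j) = F \<omega> $$ (j, i)" if "\<omega> \<in> space M" for \<omega>
    using has_mean_matD(2)[OF F that] ij by simp
qed (use has_mean_matD(1,2)[OF F] in auto)

lemma has_mean_mat_mult_left:
  assumes A: "A \<in> carrier_mat p m" and F: "has_mean_mat M m n F C"
  shows "has_mean_mat M p n (\<lambda>\<omega>. A * F \<omega>) (A * C)"
proof (rule has_mean_matI)
  fix i j assume ij: "i < p" "j < n"
  have "has_bochner_integral M (\<lambda>\<omega>. \<Sum>k<m. A $$ (i, k) * F \<omega> $$ (k, j)) (\<Sum>k<m. A $$ (i, k) * C $$ (k, j))"
    using has_mean_matD(3)[OF F] ij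
    by (intro has_bochner_integral_sum has_bochner_integral_mult_right) auto
  then show "has_bochner_integral M (\<lambda>\<omega>. \<Sum>k<m. A $$ (i, k) * F \<omega> $$ (k, j)) ((A * C) $$ (i, j))"
    using A has_mean_matD(1)[OF F] ij by (simp add: scalar_prod_def atLeast0LessThan)
  show "(A * F \<omega>) $$ (i, j) = (\<Sum>k<m. A $$ (i, k) * F \<omega> $$ (k, j))" if "\<omega> \<in> space M" for \<omega>
    using A has_mean_matD(2)[OF F that] ij by (simp add: scalar_prod_def atLeast0LessThan)
qed (use A has_mean_matD(1,2)[OF F] in auto)

text \<open>Transposition reduces this to multiplication from the left, so the sums are handled only
  once.\<close>

lemma has_mean_mat_mult_right:
  assumes F: "has_mean_mat M m n F C" and A: "A \<in> carrier_mat n p"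
  shows "has_mean_mat M m p (\<lambda>\<omega>. F \<omega> * A) (C * A)"
proof -
  have "has_mean_mat M m p (\<lambda>\<omega>. (A\<^sup>T * (F \<omega>)\<^sup>T)\<^sup>T) ((A\<^sup>T * C\<^sup>T)\<^sup>T)"
    using A by (intro has_mean_mat_transpose[OF has_mean_mat_mult_left[OF _ has_mean_mat_transpose[OF F]]]) simp
  moreover have "(A\<^sup>T * B\<^sup>T)\<^sup>T = B * A" if "B \<in> carrier_mat m n" for B
    using A that by (simp add: transpose_mult[of _ p n _ m])
  ultimately show ?thesis
    using has_mean_matD(1,2)[OF F] by (auto intro: has_mean_mat_cong)
qed

lemma has_mean_mat_trace:
  assumes F: "has_mean_mat M n n F C"
  shows "has_bochner_integral M (\<lambda>\<omega>. mat_trace (F \<omega>)) (mat_trace C)"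
proof -
  have "has_bochner_integral M (\<lambda>\<omega>. \<Sum>i<n. F \<omega> $$ (i, i)) (\<Sum>i<n. C $$ (i, i))"
    using has_mean_matD(3)[OF F] by (intro has_bochner_integral_sum) auto
  moreover have "mat_trace (F \<omega>) = (\<Sum>i<n. F \<omega> $$ (i, i))" if "\<omega> \<in> space M" for \<omega>
    using has_mean_matD(2)[OF F that] by (simp add: mat_trace_def)
  moreover have "mat_trace C = (\<Sum>i<n. C $$ (i, i))"
    using has_mean_matD(1)[OF F] by (simp add: mat_trace_def)
  ultimately show ?thesis by (simp cong: has_bochner_integral_cong)
qed

lemma quadratic_form_expectation:
  assumes H: "H \<in> carrier_mat n n" and z: "\<And>\<omega>. \<omega> \<in> space M \<Longrightarrow> z \<omega> \<in> carrier_vec n"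
    and S: "has_mean_mat M n n (\<lambda>\<omega>. outer_prod (z \<omega>) (z \<omega>)) S"
  shows "has_bochner_integral M (\<lambda>\<omega>. z \<omega> \<bullet> (H *\<^sub>v z \<omega>)) (mat_trace (H * S))"
  using has_mean_mat_trace[OF has_mean_mat_mult_left[OF H S]]
  by (rule has_bochner_integral_cong[OF refl _ refl, THEN iffD1, rotated])
    (rule mat_trace_mult_outer_prod[OF H z z])

lemma second_moment_linear_combination:
  assumes A: "A \<in> carrier_mat p m" and D: "D \<in> carrier_mat p n"
    and x: "\<And>\<omega>. \<omega> \<in> space M \<Longrightarrow> x \<omega> \<in> carrier_vec m"
    and w: "\<And>\<omega>. \<omega> \<in> space M \<Longrightarrow> w \<omega> \<in> carrier_vec n"
    and xx: "has_mean_mat M m m (\<lambda>\<omega>. outer_prod (x \<omega>) (x \<omega>)) S"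
    and xw: "has_mean_mat M m n (\<lambda>\<omega>. outer_prod (x \<omega>) (w \<omega>)) (0\<^sub>m m n)"
    and ww: "has_mean_mat M n n (\<lambda>\<omega>. outer_prod (w \<omega>) (w \<omega>)) (1\<^sub>m n)"
  shows "has_mean_mat M p p
    (\<lambda>\<omega>. outer_prod (A *\<^sub>v x \<omega> + D *\<^sub>v w \<omega>) (A *\<^sub>v x \<omega> + D *\<^sub>v w \<omega>)) (A * S * A\<^sup>T + D * D\<^sup>T)"
proof -
  have wx: "has_mean_mat M n m (\<lambda>\<omega>. outer_prod (w \<omega>) (x \<omega>)) (0\<^sub>m n m)"
    using has_mean_mat_transpose[OF xw] by (simp add: transpose_outer_prod)
  have AT: "A\<^sup>T \<in> carrier_mat m p" and DT: "D\<^sup>T \<in> carrier_mat n p"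
    using A D by auto
  have S: "S \<in> carrier_mat m m" by (rule has_mean_matD(1)[OF xx])
  \<comment> \<open>The integrand is grouped exactly as the outer product unfolds when its right
    argument is expanded before its left one. Both cross terms contribute a zero matrix to the
    mean.\<close>
  have mean: "has_mean_mat M p p
      (\<lambda>\<omega>. (A * outer_prod (x \<omega>) (x \<omega>) + D * outer_prod (w \<omega>) (x \<omega>)) * A\<^sup>T +
           (A * outer_prod (x \<omega>) (w \<omega>) + D * outer_prod (w \<omega>) (w \<omega>)) * D\<^sup>T)
      ((A * S + D * 0\<^sub>m n m) * A\<^sup>T + (A * 0\<^sub>m m n + D * 1\<^sub>m n) * D\<^sup>T)"
    by (intro has_mean_mat_add has_mean_mat_mult_right[OF _ AT] has_mean_mat_mult_right[OF _ DT]
        has_mean_mat_mult_left[OF A] has_mean_mat_mult_left[OF D] xx xw wx ww)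
  have eq: "(A * S + D * 0\<^sub>m n m) * A\<^sup>T + (A * 0\<^sub>m m n + D * 1\<^sub>m n) * D\<^sup>T
      = A * S * A\<^sup>T + D * D\<^sup>T"
    using A D S by simp
  show ?thesis
  proof (rule has_mean_mat_cong[OF mean[unfolded eq]])
    fix \<omega> assume \<omega>: "\<omega> \<in> space M"
    let ?x = "x \<omega>" and ?w = "w \<omega>"
    have c: "A *\<^sub>v ?x \<in> carrier_vec p" "D *\<^sub>v ?w \<in> carrier_vec p"
      using A D x[OF \<omega>] w[OF \<omega>] by auto
    show "(A * outer_prod ?x ?x + D * outer_prod ?w ?x) * A\<^sup>T +
           (A * outer_prod ?x ?w + D * outer_prod ?w ?w) * D\<^sup>T
        = outer_prod (A *\<^sub>v ?x + D *\<^sub>v ?w) (A *\<^sub>v ?x + D *\<^sub>v ?w)"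
      unfolding outer_prod_add_right[OF c] outer_prod_mult_right[OF A x[OF \<omega>]]
        outer_prod_mult_right[OF D w[OF \<omega>]] outer_prod_add_left[OF c]
        outer_prod_mult_left[OF A x[OF \<omega>]] outer_prod_mult_left[OF D w[OF \<omega>]] ..
  qed
qed

text \<open>Domination by the sum of squares. It serves the products of coordinates of
  \<open>x0\<close> and \<open>W\<close>: polarization would need the law of a functional of both
  vectors, and only their separate laws are given.\<close>

lemma integrable_mult_square_integrable:
  fixes f g :: "'a \<Rightarrow> real"
  assumes [measurable]: "f \<in> borel_measurable M" "g \<in> borel_measurable M"
    and "integrable M (\<lambda>\<omega>. (f \<omega>)\<^sup>2)" "integrable M (\<lambda>\<omega>. (g \<omega>)\<^sup>2)"
  shows "integrable M (\<lambda>\<omega>. f \<omega> * g \<omega>)"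
proof (rule Bochner_Integration.integrable_bound)
  show "integrable M (\<lambda>\<omega>. (f \<omega>)\<^sup>2 + (g \<omega>)\<^sup>2)" using assms(3,4) by simp
  have "\<bar>a * b\<bar> \<le> a\<^sup>2 + b\<^sup>2" for a b :: real
  proof -
    have "2 * (\<bar>a\<bar> * \<bar>b\<bar>) \<le> a\<^sup>2 + b\<^sup>2"
      using zero_le_power2[of "\<bar>a\<bar> - \<bar>b\<bar>"] by (simp add: power2_diff)
    moreover have "0 \<le> \<bar>a\<bar> * \<bar>b\<bar>" by simp
    ultimately show ?thesis unfolding abs_mult by linarith
  qed
  then show "AE \<omega> in M. norm (f \<omega> * g \<omega>) \<le> norm ((f \<omega>)\<^sup>2 + (g \<omega>)\<^sup>2)"
    by (intro AE_I2) (auto intro: order_trans)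
qed measurable

section \<open>System and weight matrices\<close>

lemma index_block_mat:
  assumes "r < m * p" "c < n * q"
  shows "block_mat m n p q F $$ (r, c) = F (r div p) (c div q) $$ (r mod p, c mod q)"
  using assms by (simp add: block_mat_def)

lemma stacked_input_mat_carrier: "stacked_input_mat N n m A B \<in> carrier_mat ((N + 1) * n) (N * m)"
  by (simp add: stacked_input_mat_def block_mat_def)

lemma stacked_state_mat_carrier: "stacked_state_mat N n A \<in> carrier_mat ((N + 1) * n) n"
  by (simp add: stacked_state_mat_def block_mat_def)

lemma stacked_input_mat_strictly_lower:
  assumes "r < (N + 1) * n" "c < N * m" "r div n \<le> c div m"
  shows "stacked_input_mat N n m A B $$ (r, c) = 0"
proof -
  \<comment> \<open>Positive block sizes keep \<open>r mod n\<close> and \<open>c mod m\<close>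
    inside the zero block, whose entries are otherwise unspecified.\<close>
  have "0 < n" "0 < m" using assms(1,2) by (auto intro: Nat.gr0I)
  then show ?thesis using assms by (simp add: stacked_input_mat_def index_block_mat)
qed

lemma augmented_input_mat_carrier:
  "augmented_input_mat N n m A B \<in> carrier_mat ((N + 2) * n) (N * m)"
proof -
  have "augmented_input_mat N n m A B \<in> carrier_mat (n + (N + 1) * n) (N * m)"
    unfolding augmented_input_mat_def
    by (intro carrier_append_rows zero_carrier_mat stacked_input_mat_carrier)
  then show ?thesis by (simp add: algebra_simps)
qed

lemma index_augmented_input_mat:
  assumes "r < (N + 2) * n" "c < N * m"
  shows "augmented_input_mat N n m A B $$ (r, c)
    = (if r < n then 0 else stacked_input_mat N n m A B $$ (r - n, c))"
proof -
  have d: "dim_row (stacked_input_mat N n m A B) = (N + 1) * n"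
    "dim_col (stacked_input_mat N n m A B) = N * m"
    using stacked_input_mat_carrier[of N n m A B] by auto
  show ?thesis
    using assms by (simp add: augmented_input_mat_def append_rows_def d)
qed

lemma augmented_state_mat_carrier: "augmented_state_mat N n A \<in> carrier_mat ((N + 2) * n) (2 * n)"
proof (rule carrier_matI)
  have d: "dim_row (stacked_state_mat N n A) = (N + 1) * n" "dim_col (stacked_state_mat N n A) = n"
    using stacked_state_mat_carrier[of N n A] by auto
  show "dim_row (augmented_state_mat N n A) = (N + 2) * n" "dim_col (augmented_state_mat N n A) = 2 * n"
    by (simp_all add: augmented_state_mat_def dim_diag_block_mat d)
qed

lemma append_cols_carrier:
  "A \<in> carrier_mat m n \<Longrightarrow> B \<in> carrier_mat m p \<Longrightarrow> append_cols A B \<in> carrier_mat m (n + p)"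
  unfolding append_cols_def carrier_mat_def by simp

lemma index_append_cols:
  assumes "A \<in> carrier_mat m n" "B \<in> carrier_mat m p" "r < m" "c < n + p"
  shows "append_cols A B $$ (r, c) = (if c < n then A $$ (r, c) else B $$ (r, c - n))"
  using assms by (simp add: append_cols_def)

text \<open>The block strictly lower triangular \<open>\<B> L\<^sub>X\<close> makes \<open>1 - \<B> L\<close> unit lower triangular entrywise.\<close>

lemma closed_loop_det:
  assumes L1: "L1 \<in> carrier_mat (N * m) n"
    and LX: "LX \<in> carrier_mat (N * m) ((N + 1) * n)" "block_lower_triangular m n LX"
  shows "det (1\<^sub>m ((N + 2) * n) - augmented_input_mat N n m A B * append_cols L1 LX) = 1"
proof -
  let ?B = "augmented_input_mat N n m A B" and ?L = "append_cols L1 LX"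
  let ?T = "1\<^sub>m ((N + 2) * n) - ?B * ?L"
  have B: "?B \<in> carrier_mat ((N + 2) * n) (N * m)" by (rule augmented_input_mat_carrier)
  have L: "?L \<in> carrier_mat (N * m) ((N + 2) * n)"
    using append_cols_carrier[OF L1 LX(1)] by (simp add: algebra_simps)
  have T: "?T \<in> carrier_mat ((N + 2) * n) ((N + 2) * n)"
    using B L by auto
  have vanish: "(?B * ?L) $$ (r, c) = 0" if rc: "r \<le> c" "c < (N + 2) * n" for r c
  proof -
    have "?B $$ (r, k) * ?L $$ (k, c) = 0" if k: "k < N * m" for k
    \<comment> \<open>In the first case the factor from the input matrix vanishes: row
      \<open>r\<close> belongs to the constant block, or input block \<open>k div m\<close> acts
      only on later states. Columns of \<open>L1\<close> have \<open>c < n\<close>, hence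
      \<open>r < n\<close>, and fall under this case. Otherwise the input block precedes the state
      block of \<open>r\<close>, hence also that of \<open>c\<close>, and causality of
      \<open>LX\<close> makes the other factor vanish.\<close>
    proof (cases "r < n \<or> (r - n) div n \<le> k div m")
      case True
      then have "?B $$ (r, k) = 0"
        using rc k stacked_input_mat_strictly_lower[of "r - n" N n k m A B]
        by (auto simp: index_augmented_input_mat algebra_simps)
      then show ?thesis by simp
    next
      case False
      then have r: "n \<le> r" and kr: "k div m < (r - n) div n" by auto
      have "(r - n) div n \<le> (c - n) div n"
        using rc by (intro div_le_mono) simp
      with kr have "k div m < (c - n) div n" by simp
      then have "LX $$ (k, c - n) = 0"
        using LX rc r k unfolding block_lower_triangular_def by (auto simp: algebra_simps)
      then have "?L $$ (k, c) = 0"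
        using rc r k by (subst index_append_cols[OF L1 LX(1)]) (auto simp: algebra_simps)
      then show ?thesis by simp
    qed
    then show ?thesis
      using B L rc by (auto simp: scalar_prod_def intro!: sum.neutral)
  qed
  have "det ?T = prod_list (diag_mat ?T)"
    using B L vanish by (intro det_lower_triangular[OF _ T]) auto
  also have "\<dots> = (\<Prod>i = 0..<(N + 2) * n. ?T $$ (i, i))"
    unfolding prod_list_diag_prod carrier_matD(1)[OF T] ..
  also have "\<dots> = 1"
    using B L vanish by (intro prod.neutral) auto
  finally show ?thesis .
qed

text \<open>\<open>mat_inverse\<close> returns an option, and \<open>the None\<close> would have
  unknown dimensions; a nonzero determinant excludes that case. The argument
  \<open>undefined\<close> fills the record extension slot of \<open>ring_mat\<close>, on which
  being a unit does not depend.\<close>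

lemma mat_inverse_carrier:
  fixes A :: "'a :: field mat"
  assumes A: "A \<in> carrier_mat n n" and "det A \<noteq> 0"
  shows "the (mat_inverse A) \<in> carrier_mat n n"
proof -
  obtain A' where "mat_inverse A = Some A'"
    using mat_inverse(1)[OF A, of undefined] det_non_zero_imp_unit[OF assms, of undefined]
    by (cases "mat_inverse A") auto
  then show ?thesis using mat_inverse(2)[OF A] by simp
qed

section \<open>Positive semidefinite block matrices and congruences\<close>

lemma diag_block_mat_pair:
  "diag_block_mat [A, B] = four_block_mat A (0\<^sub>m (dim_row A) (dim_col B)) (0\<^sub>m (dim_row B) (dim_col A)) B"
  unfolding diag_block_mat.simps(2)[of A] diag_block_mat_singleton Let_def ..

lemma psd_mat_four_block:
  assumes A: "psd_mat m A" and B: "psd_mat n B"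
  shows "psd_mat (m + n) (four_block_mat A (0\<^sub>m m n) (0\<^sub>m n m) B)"
  unfolding psd_mat_def
proof (intro conjI ballI)
  have Ac: "A \<in> carrier_mat m m" and Bc: "B \<in> carrier_mat n n"
    using A B by (simp_all add: psd_mat_def)
  show "four_block_mat A (0\<^sub>m m n) (0\<^sub>m n m) B \<in> carrier_mat (m + n) (m + n)"
    using Ac Bc by simp
  show "(four_block_mat A (0\<^sub>m m n) (0\<^sub>m n m) B)\<^sup>T = four_block_mat A (0\<^sub>m m n) (0\<^sub>m n m) B"
    using A B by (subst transpose_four_block_mat[OF Ac _ _ Bc]) (simp_all add: psd_mat_def)
  fix v :: "real vec" assume v: "v \<in> carrier_vec (m + n)"
  define a b where "a = vec_first v m" and "b = vec_last v n"
  have ab: "a \<in> carrier_vec m" "b \<in> carrier_vec n" and v_eq: "v = a @\<^sub>v b"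
    using v by (simp_all add: a_def b_def)
  have "v \<bullet> (four_block_mat A (0\<^sub>m m n) (0\<^sub>m n m) B *\<^sub>v v) = a \<bullet> (A *\<^sub>v a) + b \<bullet> (B *\<^sub>v b)"
    unfolding v_eq mult_mat_vec_split[OF Ac Bc ab]
    using Ac Bc ab by (intro scalar_prod_append) auto
  also have "0 \<le> \<dots>"
    using A B ab by (simp add: psd_mat_def)
  finally show "0 \<le> v \<bullet> (four_block_mat A (0\<^sub>m m n) (0\<^sub>m n m) B *\<^sub>v v)" .
qed

lemma psd_mat_zero: "psd_mat n (0\<^sub>m n n)"
  by (auto simp: psd_mat_def scalar_prod_def)

lemma psd_mat_diag_block:
  assumes "\<And>A. A \<in> set As \<Longrightarrow> psd_mat n A"
  shows "psd_mat (length As * n) (diag_block_mat As)"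
  using assms
proof (induction As)
  case Nil
  then show ?case using psd_mat_zero[of 0] by simp
next
  case (Cons A As)
  have A: "psd_mat n A" and As: "psd_mat (length As * n) (diag_block_mat As)"
    using Cons by auto
  then have "dim_row A = n" "dim_col A = n"
    "dim_row (diag_block_mat As) = length As * n" "dim_col (diag_block_mat As) = length As * n"
    by (auto simp: psd_mat_def)
  with psd_mat_four_block[OF A As] show ?case by (simp add: Let_def)
qed

lemma pd_imp_psd: "pd_mat n A \<Longrightarrow> psd_mat n A"
proof (unfold pd_mat_def psd_mat_def, elim conjE, intro conjI ballI)
  fix v :: "real vec"
  assume pos: "\<forall>v\<in>carrier_vec n. v \<noteq> 0\<^sub>v n \<longrightarrow> 0 < v \<bullet> (A *\<^sub>v v)" and v: "v \<in> carrier_vec n"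
    and A: "A \<in> carrier_mat n n"
  show "0 \<le> v \<bullet> (A *\<^sub>v v)"
  proof (cases "v = 0\<^sub>v n")
    case True
    have "A *\<^sub>v v \<in> carrier_vec n" using A v by simp
    then show ?thesis unfolding True by simp
  qed (use pos v in force)
qed

lemma state_weight_psd:
  assumes "\<And>k. k < N \<Longrightarrow> psd_mat n (Q k)"
  shows "psd_mat ((N + 1) * n) (state_weight N n Q)"
proof -
  have "psd_mat (length (map Q [0..<N] @ [0\<^sub>m n n]) * n) (diag_block_mat (map Q [0..<N] @ [0\<^sub>m n n]))"
    using assms psd_mat_zero by (intro psd_mat_diag_block) auto
  then show ?thesis by (simp add: state_weight_def)
qed

lemma input_weight_psd:
  assumes "\<And>k. k < N \<Longrightarrow> pd_mat n (R k)"
  shows "psd_mat (N * n) (input_weight N R)"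
proof -
  have "psd_mat (length (map R [0..<N]) * n) (diag_block_mat (map R [0..<N]))"
    using assms by (intro psd_mat_diag_block) (auto intro: pd_imp_psd)
  then show ?thesis by (simp add: input_weight_def)
qed

lemma input_weight_index_0:
  assumes "0 < N" "0 < n" "R 0 \<in> carrier_mat n n"
  shows "input_weight N R $$ (0, 0) = R 0 $$ (0, 0)"
  using assms by (simp add: input_weight_def upt_conv_Cons Let_def)

lemma pd_mat_diag_pos:
  assumes "pd_mat n A" "i < n"
  shows "0 < A $$ (i, i)"
proof -
  have A: "A \<in> carrier_mat n n" and "0 < unit_vec n i \<bullet> (A *\<^sub>v unit_vec n i)"
    using assms by (auto simp: pd_mat_def)
  moreover have "unit_vec n i \<bullet> (A *\<^sub>v unit_vec n i) = (A *\<^sub>v unit_vec n i) $ i"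
    using A assms(2) by (intro scalar_prod_left_unit[of _ n]) auto
  moreover have "(A *\<^sub>v unit_vec n i) $ i = A $$ (i, i)"
    using A assms(2) by simp
  ultimately show ?thesis by simp
qed

text \<open>With \<open>F\<close> equal to \<open>I + BB * K\<close> and to \<open>K\<close>, this
  brings the state cost and the input cost to quadratic forms in the same vector, so that they can
  be added.\<close>

lemma quadratic_form_congruence:
  fixes F :: "real mat"
  assumes F: "F \<in> carrier_mat m n" and Q: "Q \<in> carrier_mat m m" and z: "z \<in> carrier_vec n"
  shows "(F *\<^sub>v z) \<bullet> (Q *\<^sub>v (F *\<^sub>v z)) = z \<bullet> (F\<^sup>T * Q * F *\<^sub>v z)"
proof -
  have FT: "F\<^sup>T \<in> carrier_mat n m" using F by simp
  have c: "F *\<^sub>v z \<in> carrier_vec m" using F z by simp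
  then have Qc: "Q *\<^sub>v (F *\<^sub>v z) \<in> carrier_vec m" using Q by simp
  have "F\<^sup>T * Q * F *\<^sub>v z = F\<^sup>T *\<^sub>v (Q *\<^sub>v (F *\<^sub>v z))"
    unfolding assoc_mult_mat_vec[OF mult_carrier_mat[OF FT Q] F z] assoc_mult_mat_vec[OF FT Q c] ..
  moreover have "z \<bullet> (F\<^sup>T *\<^sub>v (Q *\<^sub>v (F *\<^sub>v z))) = (F\<^sup>T *\<^sub>v (Q *\<^sub>v (F *\<^sub>v z))) \<bullet> z"
    using FT Qc z by (intro comm_scalar_prod[of _ n]) auto
  moreover have "(F\<^sup>T *\<^sub>v (Q *\<^sub>v (F *\<^sub>v z))) \<bullet> z = (Q *\<^sub>v (F *\<^sub>v z)) \<bullet> (F *\<^sub>v z)"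
    by (rule transpose_vec_mult_scalar[OF F z Qc])
  ultimately show ?thesis using comm_scalar_prod[OF c Qc] by simp
qed

text \<open>A diagonal entry is the quadratic form at a unit vector; by congruence it is the form of
  \<open>Q\<close> at the \<open>i\<close>-th column of \<open>F\<close>.\<close>

lemma psd_mat_congruence_diag_nonneg:
  assumes Q: "psd_mat m Q" and F: "F \<in> carrier_mat m n" and i: "i < n"
  shows "0 \<le> (F\<^sup>T * Q * F) $$ (i, i)"
proof -
  have Qc: "Q \<in> carrier_mat m m" using Q by (simp add: psd_mat_def)
  have H: "F\<^sup>T * Q * F \<in> carrier_mat n n" using F Qc by auto
  have "(F\<^sup>T * Q * F) $$ (i, i) = unit_vec n i \<bullet> (F\<^sup>T * Q * F *\<^sub>v unit_vec n i)"
  proof -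
    have "unit_vec n i \<bullet> (F\<^sup>T * Q * F *\<^sub>v unit_vec n i) = (F\<^sup>T * Q * F *\<^sub>v unit_vec n i) $ i"
      using H i by (intro scalar_prod_left_unit[of _ n]) auto
    also have "\<dots> = row (F\<^sup>T * Q * F) i \<bullet> unit_vec n i"
      using H i by (intro index_mult_mat_vec) auto
    also have "\<dots> = row (F\<^sup>T * Q * F) i $ i"
      using H i by (intro scalar_prod_right_unit[of _ n]) auto
    also have "\<dots> = (F\<^sup>T * Q * F) $$ (i, i)"
      using H i by (intro index_row) auto
    finally show ?thesis by (rule sym)
  qed
  also have "\<dots> = (F *\<^sub>v unit_vec n i) \<bullet> (Q *\<^sub>v (F *\<^sub>v unit_vec n i))"
    by (rule quadratic_form_congruence[OF F Qc, symmetric]) simp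
  also have "0 \<le> \<dots>"
    using Q F by (simp add: psd_mat_def)
  finally show ?thesis .
qed

section \<open>Trace polynomials\<close>

lemma mat_trace_comm:
  assumes "A \<in> carrier_mat m n" "B \<in> carrier_mat n m"
  shows "mat_trace (A * B) = mat_trace (B * A)"
  unfolding mat_trace_mult[OF assms] mat_trace_mult[OF assms(2,1)]
  by (subst sum.swap) (simp add: mult.commute)

text \<open>The Frobenius inner product; it exposes the entries of a transposed factor as the
  variables of a polynomial.\<close>

lemma mat_trace_transpose_mult:
  assumes "A \<in> carrier_mat m n" "B \<in> carrier_mat m n"
  shows "mat_trace (A\<^sup>T * B) = (\<Sum>i<m. \<Sum>j<n. A $$ (i, j) * B $$ (i, j))"
proof -
  have "mat_trace (A\<^sup>T * B) = (\<Sum>j<n. \<Sum>i<m. A\<^sup>T $$ (j, i) * B $$ (i, j))"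
    using assms by (intro mat_trace_mult) auto
  also have "\<dots> = (\<Sum>j<n. \<Sum>i<m. A $$ (i, j) * B $$ (i, j))"
    using assms by simp
  finally show ?thesis by (subst (asm) sum.swap)
qed

lemma index_triple_mult:
  assumes "A \<in> carrier_mat m k" "G \<in> carrier_mat k l" "B \<in> carrier_mat l n" "i < m" "j < n"
  shows "(A * (G * B)) $$ (i, j) = (\<Sum>a<k. \<Sum>b<l. A $$ (i, a) * G $$ (a, b) * B $$ (b, j))"
  using assms by (simp add: scalar_prod_def atLeast0LessThan sum_distrib_left mult.assoc)

lemma sum_indicator_entry:
  fixes h :: "nat \<Rightarrow> nat \<Rightarrow> real"
  assumes "k < m" "l < n"
  shows "(\<Sum>i<m. \<Sum>j<n. h i j * (if i = k \<and> j = l then 1 else 0)) = h k l"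
proof -
  have "(\<Sum>i<m. \<Sum>j<n. h i j * (if i = k \<and> j = l then 1 else 0))
      = (\<Sum>i<m. if i = k then h i l else 0)"
  proof (rule sum.cong[OF refl])
    fix i
    have "(\<Sum>j<n. h i j * (if i = k \<and> j = l then 1 else 0)) 
        = (\<Sum>j<n. if j = l then (if i = k then h i l else 0) else 0)"
      by (rule sum.cong) auto
    then show "(\<Sum>j<n. h i j * (if i = k \<and> j = l then 1 else 0)) = (if i = k then h i l else 0)"
      using assms(2) by simp
  qed
  then show ?thesis using assms(1) by simp
qed

text \<open>The right-hand side is sorted by degree in \<open>G\<close>: one constant term, two
  linear terms and one quadratic term. The linear terms are not transposes of each other, because
  \<open>Q\<close> is an arbitrary square matrix here.\<close>

lemma affine_congruence:
  fixes B G Q :: "real mat"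
  assumes B: "B \<in> carrier_mat p m" and G: "G \<in> carrier_mat m p" and Q: "Q \<in> carrier_mat p p"
  shows "(1\<^sub>m p + B * G)\<^sup>T * Q * (1\<^sub>m p + B * G)
    = Q + Q * B * G + (G\<^sup>T * (B\<^sup>T * Q) + G\<^sup>T * (B\<^sup>T * Q * B) * G)"
proof -
  have GT: "G\<^sup>T \<in> carrier_mat p m" and BT: "B\<^sup>T \<in> carrier_mat m p" and BG: "B * G \<in> carrier_mat p p"
    using B G by auto
  have BTQ: "B\<^sup>T * Q \<in> carrier_mat m p" using BT Q by auto
  let ?Y = "G\<^sup>T * (B\<^sup>T * Q)"
  have Y: "?Y \<in> carrier_mat p p" using GT BTQ by auto
  have "(1\<^sub>m p + B * G)\<^sup>T = 1\<^sub>m p + G\<^sup>T * B\<^sup>T"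
    unfolding transpose_add[OF one_carrier_mat BG] transpose_mult[OF B G] transpose_one ..
  moreover have "(1\<^sub>m p + G\<^sup>T * B\<^sup>T) * Q = 1\<^sub>m p * Q + G\<^sup>T * B\<^sup>T * Q"
    using GT BT by (intro add_mult_distrib_mat[OF one_carrier_mat _ Q]) auto
  moreover have "1\<^sub>m p * Q = Q" by (rule left_mult_one_mat[OF Q])
  moreover have "G\<^sup>T * B\<^sup>T * Q = ?Y" by (rule assoc_mult_mat[OF GT BT Q])
  ultimately have "(1\<^sub>m p + B * G)\<^sup>T * Q = Q + ?Y" by (simp only:)
  moreover have "(Q + ?Y) * (1\<^sub>m p + B * G) = Q * (1\<^sub>m p + B * G) + ?Y * (1\<^sub>m p + B * G)"
    by (rule add_mult_distrib_mat[OF Q Y add_carrier_mat[OF BG]])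
  moreover have "Q * (1\<^sub>m p + B * G) = Q * 1\<^sub>m p + Q * (B * G)"
      "?Y * (1\<^sub>m p + B * G) = ?Y * 1\<^sub>m p + ?Y * (B * G)"
    by (rule mult_add_distrib_mat[OF Q one_carrier_mat BG] mult_add_distrib_mat[OF Y one_carrier_mat BG])+
  moreover have "Q * 1\<^sub>m p = Q" by (rule right_mult_one_mat[OF Q])
  moreover have "?Y * 1\<^sub>m p = ?Y" by (rule right_mult_one_mat[OF Y])
  moreover have "Q * (B * G) = Q * B * G"
    by (rule assoc_mult_mat[OF Q B G, symmetric])
  moreover have "?Y * (B * G) = G\<^sup>T * (B\<^sup>T * Q * B) * G"
    unfolding assoc_mult_mat[OF Y B G, symmetric] assoc_mult_mat[OF GT BTQ B] ..
  ultimately show ?thesis by (simp only:)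
qed

text \<open>The condition \<open>nz\<close> isolates what definiteness of the weights and the second
  moment have to supply; everything else is algebra for arbitrary matrices of matching
  sizes.\<close>

lemma quadratic_in_entries_trace:
  fixes B Q R S :: "real mat"
  assumes B: "B \<in> carrier_mat p m" and Q: "Q \<in> carrier_mat p p" and R: "R \<in> carrier_mat m m"
    and S: "S \<in> carrier_mat p p" and k: "k < m" and l: "l < p"
    and nz: "(B\<^sup>T * Q * B + R) $$ (k, k) * S $$ (l, l) \<noteq> 0"
  shows "quadratic_in_entries m p
    (\<lambda>G. mat_trace (((1\<^sub>m p + B * G)\<^sup>T * Q * (1\<^sub>m p + B * G) + G\<^sup>T * R * G) * S))"
proof -
  define P where "P = B\<^sup>T * Q * B + R"
  have P: "P \<in> carrier_mat m m" and BT: "B\<^sup>T \<in> carrier_mat m p"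
    using B Q R by (auto simp: P_def)
  \<comment> \<open>The two linear traces are tr(Q B G S) = tr(G S Q B), by cyclicity, and the
    Frobenius product of \<open>G\<close> with \<open>B\<^sup>T * Q * S\<close>; this explains the
    swapped indices in the first summand. The coefficients \<open>q\<close> come from the Frobenius
    product of \<open>G\<close> with \<open>P * G * S\<close>, with the entry of the last product
    expanded as a triple product.\<close>
  define lin where "lin i j = (S * (Q * B)) $$ (j, i) + (B\<^sup>T * Q * S) $$ (i, j)" for i j
  define q where "q i j i' j' = P $$ (i, i') * S $$ (j', j)" for i j i' j'
  have "mat_trace (((1\<^sub>m p + B * G)\<^sup>T * Q * (1\<^sub>m p + B * G) + G\<^sup>T * R * G) * S)
      = mat_trace (Q * S) + (\<Sum>i<m. \<Sum>j<p. lin i j * G $$ (i, j))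
        + (\<Sum>i<m. \<Sum>j<p. \<Sum>i'<m. \<Sum>j'<p. q i j i' j' * G $$ (i, j) * G $$ (i', j'))"
    if G: "G \<in> carrier_mat m p" for G
  proof -
    let ?A = "B\<^sup>T * Q * B" and ?C = "Q * B * G" and ?Y = "G\<^sup>T * (B\<^sup>T * Q)"
    have GT: "G\<^sup>T \<in> carrier_mat p m" using G by simp
    have c: "Q * B \<in> carrier_mat p m" "B\<^sup>T * Q \<in> carrier_mat m p" "?A \<in> carrier_mat m m"
      using B BT Q by auto
    have d: "?C \<in> carrier_mat p p" "?Y \<in> carrier_mat p p" "G\<^sup>T * ?A * G \<in> carrier_mat p p"
      "G\<^sup>T * R * G \<in> carrier_mat p p" "G\<^sup>T * P * G \<in> carrier_mat p p"
      "G\<^sup>T * ?A \<in> carrier_mat p m" "G\<^sup>T * R \<in> carrier_mat p m" "G\<^sup>T * P \<in> carrier_mat p m"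
      using c G GT R P by auto
    have GS: "G * S \<in> carrier_mat m p" using G S by auto
    have "G\<^sup>T * P * G = G\<^sup>T * ?A * G + G\<^sup>T * R * G"
      unfolding P_def mult_add_distrib_mat[OF GT c(3) R] by (rule add_mult_distrib_mat[OF d(6,7) G])
    then have "(1\<^sub>m p + B * G)\<^sup>T * Q * (1\<^sub>m p + B * G) + G\<^sup>T * R * G
        = Q + ?C + (?Y + G\<^sup>T * P * G)"
      unfolding affine_congruence[OF B G Q] using Q d(1-4) by (simp add: assoc_add_mat[of _ p p])
    moreover have "(Q + ?C + (?Y + G\<^sup>T * P * G)) * S = (Q * S + ?C * S) + (?Y * S + G\<^sup>T * P * G * S)"
    proof -
      have e: "Q + ?C \<in> carrier_mat p p" "?Y + G\<^sup>T * P * G \<in> carrier_mat p p"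
        using Q d by auto
      show ?thesis
        unfolding add_mult_distrib_mat[OF e S] add_mult_distrib_mat[OF Q d(1) S]
          add_mult_distrib_mat[OF d(2,5) S] ..
    qed
    moreover have "mat_trace ((Q * S + ?C * S) + (?Y * S + G\<^sup>T * P * G * S))
        = mat_trace (Q * S) + mat_trace (?C * S) + (mat_trace (?Y * S) + mat_trace (G\<^sup>T * P * G * S))"
    proof -
      have e: "Q * S \<in> carrier_mat p p" "?C * S \<in> carrier_mat p p" "?Y * S \<in> carrier_mat p p"
        "G\<^sup>T * P * G * S \<in> carrier_mat p p"
        using Q d S by auto
      show ?thesis
        unfolding mat_trace_add[OF add_carrier_mat[OF e(2)] add_carrier_mat[OF e(4)]]
          mat_trace_add[OF e(1,2)] mat_trace_add[OF e(3,4)] ..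
    qed
    moreover have "mat_trace (?C * S) = (\<Sum>i<m. \<Sum>j<p. (S * (Q * B)) $$ (j, i) * G $$ (i, j))"
    proof -
      have SQB: "S * (Q * B) \<in> carrier_mat p m" using S c by auto
      have "mat_trace (?C * S) = mat_trace (Q * B * (G * S))"
        by (simp only: assoc_mult_mat[OF c(1) G S])
      also have "\<dots> = mat_trace (G * (S * (Q * B)))"
        unfolding mat_trace_comm[OF c(1) GS] assoc_mult_mat[OF G S c(1)] ..
      also have "\<dots> = (\<Sum>i<m. \<Sum>j<p. G $$ (i, j) * (S * (Q * B)) $$ (j, i))"
        by (rule mat_trace_mult[OF G SQB])
      finally show ?thesis by (simp only: mult.commute)
    qed
    moreover have "mat_trace (?Y * S) = (\<Sum>i<m. \<Sum>j<p. (B\<^sup>T * Q * S) $$ (i, j) * G $$ (i, j))"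
    proof -
      have BQS: "B\<^sup>T * Q * S \<in> carrier_mat m p" using S c by auto
      show ?thesis
        unfolding assoc_mult_mat[OF GT c(2) S] mat_trace_transpose_mult[OF G BQS]
        by (simp only: mult.commute)
    qed
    moreover have "mat_trace (G\<^sup>T * P * G * S)
        = (\<Sum>i<m. \<Sum>j<p. \<Sum>i'<m. \<Sum>j'<p. q i j i' j' * G $$ (i, j) * G $$ (i', j'))"
    proof -
      have PGS: "P * (G * S) \<in> carrier_mat m p" using P GS by auto
      have "mat_trace (G\<^sup>T * P * G * S) = mat_trace (G\<^sup>T * (P * (G * S)))"
        unfolding assoc_mult_mat[OF d(8) G S] assoc_mult_mat[OF GT P GS] ..
      also have "\<dots> = (\<Sum>i<m. \<Sum>j<p. G $$ (i, j) * (P * (G * S)) $$ (i, j))"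
        by (rule mat_trace_transpose_mult[OF G PGS])
      also have "\<dots> = (\<Sum>i<m. \<Sum>j<p. \<Sum>i'<m. \<Sum>j'<p. q i j i' j' * G $$ (i, j) * G $$ (i', j'))"
        by (intro sum.cong refl)
          (simp only: index_triple_mult[OF P G S] lessThan_iff sum_distrib_left q_def ac_simps)
      finally show ?thesis .
    qed
    ultimately show ?thesis
      by (simp only: lin_def distrib_right sum.distrib add.assoc)
  qed
  moreover have "(\<Sum>i<m. \<Sum>j<p. \<Sum>i'<m. \<Sum>j'<p.
      q i j i' j' * E $$ (i, j) * E $$ (i', j')) \<noteq> 0"
    if E: "E = mat m p (\<lambda>(i, j). if i = k \<and> j = l then 1 else 0)" for E
  proof -
    have "(\<Sum>i<m. \<Sum>j<p. \<Sum>i'<m. \<Sum>j'<p. q i j i' j' * E $$ (i, j) * E $$ (i', j'))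
      = (\<Sum>i<m. \<Sum>j<p. \<Sum>i'<m. \<Sum>j'<p. q i j i' j' * E $$ (i, j) * (if i' = k \<and> j' = l then 1 else 0))"
      by (simp add: E)
    also have "\<dots> = (\<Sum>i<m. \<Sum>j<p. q i j k l * E $$ (i, j))"
      by (simp only: sum_indicator_entry[OF k l])
    also have "\<dots> = (\<Sum>i<m. \<Sum>j<p. q i j k l * (if i = k \<and> j = l then 1 else 0))"
      by (simp add: E)
    also have "\<dots> = q k l k l"
      by (rule sum_indicator_entry[OF k l])
    finally show ?thesis using nz by (simp add: q_def P_def)
  qed
  moreover have "mat m p (\<lambda>(i, j). if i = k \<and> j = l then 1 else 0 :: real) \<in> carrier_mat m p"
    by simp
  ultimately show ?thesis
    unfolding quadratic_in_entries_def by blast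
qed

section \<open>Moments of the augmented state\<close>

lemma normal_vec_outer_prod:
  assumes Z: "normal_vec M n Z \<mu> \<Sigma>"
  shows "has_mean_mat M n n (\<lambda>\<omega>. outer_prod (Z \<omega>) (Z \<omega>)) (\<Sigma> + outer_prod \<mu> \<mu>)"
proof (rule has_mean_matI)
  have \<mu>: "\<mu> \<in> carrier_vec n" and \<Sigma>: "\<Sigma> \<in> carrier_mat n n"
    using Z by (simp_all add: normal_vec_def psd_mat_def)
  have Zc: "Z \<omega> \<in> carrier_vec n" if "\<omega> \<in> space M" for \<omega>
    using Z that unfolding normal_vec_def random_vec_def by blast
  show "\<Sigma> + outer_prod \<mu> \<mu> \<in> carrier_mat n n" using \<mu> by simp
  show "outer_prod (Z \<omega>) (Z \<omega>) \<in> carrier_mat n n" if "\<omega> \<in> space M" for \<omega>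
    using Zc[OF that] by simp
  fix i j assume ij: "i < n" "j < n"
  show "has_bochner_integral M (\<lambda>\<omega>. Z \<omega> $ i * Z \<omega> $ j) ((\<Sigma> + outer_prod \<mu> \<mu>) $$ (i, j))"
    using normal_vec_second_moment[OF Z ij] \<mu> \<Sigma> ij by simp
  show "outer_prod (Z \<omega>) (Z \<omega>) $$ (i, j) = Z \<omega> $ i * Z \<omega> $ j" if "\<omega> \<in> space M" for \<omega>
    using Zc[OF that] ij by simp
qed

lemma mean_append_const:
  fixes a \<mu> :: "real vec"
  assumes "prob_space M" and a: "a \<in> carrier_vec m" and Zc: "\<And>\<omega>. \<omega> \<in> space M \<Longrightarrow> Z \<omega> \<in> carrier_vec n"
    and \<mu>: "\<mu> \<in> carrier_vec n"
    and mean: "\<And>i. i < n \<Longrightarrow> has_bochner_integral M (\<lambda>\<omega>. Z \<omega> $ i) (\<mu> $ i)"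
    and i: "i < m + n"
  shows "has_bochner_integral M (\<lambda>\<omega>. (a @\<^sub>v Z \<omega>) $ i) ((a @\<^sub>v \<mu>) $ i)"
proof -
  interpret prob_space M by fact
  have const: "has_bochner_integral M (\<lambda>\<omega>. c) c" for c :: real
    using prob_space by (simp add: has_bochner_integral_iff)
  have eq: "(a @\<^sub>v Z \<omega>) $ i = (if i < m then a $ i else Z \<omega> $ (i - m))" if "\<omega> \<in> space M" for \<omega>
    using a carrier_vecD[OF Zc[OF that]] i by simp
  have eq': "(a @\<^sub>v \<mu>) $ i = (if i < m then a $ i else \<mu> $ (i - m))"
    using a \<mu> i by simp
  have "has_bochner_integral M (\<lambda>\<omega>. if i < m then a $ i else Z \<omega> $ (i - m))
      (if i < m then a $ i else \<mu> $ (i - m))"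
    using const mean[of "i - m"] i by (cases "i < m") simp_all
  then show ?thesis
    unfolding eq' by (rule has_bochner_integral_cong[OF refl _ refl, THEN iffD2, rotated]) (rule eq)
qed

text \<open>An entry that meets the constant block is a constant times a constant or a coordinate of
  \<open>Z\<close>, so its mean is already the product of means; only the lower right block acquires
  a covariance.\<close>

lemma outer_prod_append_const:
  fixes a \<mu> :: "real vec"
  assumes "prob_space M" and a: "a \<in> carrier_vec m" and Zc: "\<And>\<omega>. \<omega> \<in> space M \<Longrightarrow> Z \<omega> \<in> carrier_vec n"
    and \<mu>: "\<mu> \<in> carrier_vec n"
    and mean: "\<And>i. i < n \<Longrightarrow> has_bochner_integral M (\<lambda>\<omega>. Z \<omega> $ i) (\<mu> $ i)"
    and \<Sigma>: "\<Sigma> \<in> carrier_mat n n"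
    and ZZ: "has_mean_mat M n n (\<lambda>\<omega>. outer_prod (Z \<omega>) (Z \<omega>)) (\<Sigma> + outer_prod \<mu> \<mu>)"
  shows "has_mean_mat M (m + n) (m + n) (\<lambda>\<omega>. outer_prod (a @\<^sub>v Z \<omega>) (a @\<^sub>v Z \<omega>))
    (outer_prod (a @\<^sub>v \<mu>) (a @\<^sub>v \<mu>) + four_block_mat (0\<^sub>m m m) (0\<^sub>m m n) (0\<^sub>m n m) \<Sigma>)"
    (is "has_mean_mat M _ _ ?F (?P + ?S)")
proof (rule has_mean_matI)
  interpret prob_space M by fact
  have const: "has_bochner_integral M (\<lambda>\<omega>. c) c" for c :: real
    using prob_space by (simp add: has_bochner_integral_iff)
  show "?P + ?S \<in> carrier_mat (m + n) (m + n)" using \<Sigma> by simp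
  show "?F \<omega> \<in> carrier_mat (m + n) (m + n)" if "\<omega> \<in> space M" for \<omega>
    using a Zc[OF that] by simp
  fix i j assume ij: "i < m + n" "j < m + n"
  define f where "f \<omega> = (if i < m then a $ i else Z \<omega> $ (i - m))
      * (if j < m then a $ j else Z \<omega> $ (j - m))" for \<omega>
  show "?F \<omega> $$ (i, j) = f \<omega>" if "\<omega> \<in> space M" for \<omega>
    using a carrier_vecD[OF Zc[OF that]] ij by (simp add: f_def)
  have entry: "(?P + ?S) $$ (i, j)
      = (if i < m then a $ i else \<mu> $ (i - m)) * (if j < m then a $ j else \<mu> $ (j - m))
      + (if i < m \<or> j < m then 0 else \<Sigma> $$ (i - m, j - m))"
    using a \<mu> \<Sigma> ij by simp
  show "has_bochner_integral M f ((?P + ?S) $$ (i, j))"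
  proof (cases "i < m \<or> j < m")
    case True
    then show ?thesis unfolding f_def entry
      using const mean[of "i - m"] mean[of "j - m"] ij
      by (auto intro: has_bochner_integral_mult_left has_bochner_integral_mult_right)
  next
    case False
    then have ij': "i - m < n" "j - m < n" using ij by auto
    have "has_bochner_integral M (\<lambda>\<omega>. Z \<omega> $ (i - m) * Z \<omega> $ (j - m))
        ((\<Sigma> + outer_prod \<mu> \<mu>) $$ (i - m, j - m))"
      using has_mean_matD(3)[OF ZZ ij']
      by (rule has_bochner_integral_cong[OF refl _ refl, THEN iffD1, rotated])
        (use ij' carrier_vecD[OF Zc] in simp)
    then show ?thesis unfolding f_def entry using False ij' \<mu> \<Sigma> by (simp add: add.commute)
  qed
qed

text \<open>Second moment minus product of means; the centred product is expanded into four terms,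
  each integrable by the assumptions.\<close>

lemma covariance_mat_eq:
  assumes "prob_space M" and Zc: "\<And>\<omega>. \<omega> \<in> space M \<Longrightarrow> Z \<omega> \<in> carrier_vec n"
    and \<mu>: "\<mu> \<in> carrier_vec n"
    and mean: "\<And>i. i < n \<Longrightarrow> has_bochner_integral M (\<lambda>\<omega>. Z \<omega> $ i) (\<mu> $ i)"
    and \<Sigma>: "\<Sigma> \<in> carrier_mat n n"
    and ZZ: "has_mean_mat M n n (\<lambda>\<omega>. outer_prod (Z \<omega>) (Z \<omega>)) (outer_prod \<mu> \<mu> + \<Sigma>)"
  shows "mean_vec M n Z = \<mu>" "covariance_mat M n Z = \<Sigma>"
proof -
  interpret prob_space M by fact
  show mv: "mean_vec M n Z = \<mu>"
    using \<mu> has_bochner_integral_integral_eq[OF mean] by (intro eq_vecI) (simp_all add: mean_vec_def)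
  have "has_mean_mat M n n (\<lambda>\<omega>. outer_prod (Z \<omega> - \<mu>) (Z \<omega> - \<mu>)) \<Sigma>"
  proof (rule has_mean_matI[OF \<Sigma>])
    show "outer_prod (Z \<omega> - \<mu>) (Z \<omega> - \<mu>) \<in> carrier_mat n n" if "\<omega> \<in> space M" for \<omega>
      using Zc[OF that] \<mu> by simp
    fix i j assume ij: "i < n" "j < n"
    show "outer_prod (Z \<omega> - \<mu>) (Z \<omega> - \<mu>) $$ (i, j)
        = outer_prod (Z \<omega>) (Z \<omega>) $$ (i, j) - \<mu> $ i * Z \<omega> $ j - \<mu> $ j * Z \<omega> $ i + \<mu> $ i * \<mu> $ j"
      if "\<omega> \<in> space M" for \<omega>
      using carrier_vecD[OF Zc[OF that]] \<mu> ij by (simp add: algebra_simps)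
    have "has_bochner_integral M (\<lambda>\<omega>. \<mu> $ i * \<mu> $ j) (\<mu> $ i * \<mu> $ j)"
      using prob_space by (simp add: has_bochner_integral_iff)
    from has_bochner_integral_add[OF has_bochner_integral_diff[OF
        has_bochner_integral_diff[OF has_mean_matD(3)[OF ZZ ij]
        has_bochner_integral_mult_right[OF mean[OF ij(2)], of "\<mu> $ i"]]
        has_bochner_integral_mult_right[OF mean[OF ij(1)], of "\<mu> $ j"]] this]
    show "has_bochner_integral M
        (\<lambda>\<omega>. outer_prod (Z \<omega>) (Z \<omega>) $$ (i, j) - \<mu> $ i * Z \<omega> $ j - \<mu> $ j * Z \<omega> $ i + \<mu> $ i * \<mu> $ j)
        (\<Sigma> $$ (i, j))"
      using \<mu> \<Sigma> ij by simp
  qed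
  then show "covariance_mat M n Z = \<Sigma>"
    unfolding covariance_mat_def mv by (rule mean_mat_eq)
qed

lemma normal_vec_square_integrable:
  assumes "normal_vec M n Z \<mu> \<Sigma>" "i < n"
  shows "(\<lambda>\<omega>. Z \<omega> $ i) \<in> borel_measurable M" "integrable M (\<lambda>\<omega>. (Z \<omega> $ i)\<^sup>2)"
proof -
  show "(\<lambda>\<omega>. Z \<omega> $ i) \<in> borel_measurable M"
    using assms unfolding normal_vec_def random_vec_def by blast
  show "integrable M (\<lambda>\<omega>. (Z \<omega> $ i)\<^sup>2)"
    using normal_vec_second_moment[OF assms assms(2)]
    unfolding power2_eq_square has_bochner_integral_iff by (rule conjunct1)
qed

text \<open>Upgrades a bare \<open>mean_mat\<close> to the relation with integrability. It is
  applied to \<open>x0\<close> with \<open>W\<close> and to \<open>W\<close> with itself, where the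
  theorem prescribes the value of \<open>mean_mat\<close>.\<close>

lemma has_mean_mat_normal_outer_prod:
  assumes x: "normal_vec M m x \<mu> \<Sigma>" and w: "normal_vec M n w \<nu> \<Theta>"
  shows "has_mean_mat M m n (\<lambda>\<omega>. outer_prod (x \<omega>) (w \<omega>)) (mean_mat M m n (\<lambda>\<omega>. outer_prod (x \<omega>) (w \<omega>)))"
proof (rule has_mean_matI)
  have xc: "x \<omega> \<in> carrier_vec m" and wc: "w \<omega> \<in> carrier_vec n" if "\<omega> \<in> space M" for \<omega>
    using x w that unfolding normal_vec_def random_vec_def by blast+
  show "mean_mat M m n (\<lambda>\<omega>. outer_prod (x \<omega>) (w \<omega>)) \<in> carrier_mat m n"
    by (simp add: mean_mat_def)
  show "outer_prod (x \<omega>) (w \<omega>) \<in> carrier_mat m n" if "\<omega> \<in> space M" for \<omega>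
    using xc[OF that] wc[OF that] by simp
  fix i j assume ij: "i < m" "j < n"
  show eq: "outer_prod (x \<omega>) (w \<omega>) $$ (i, j) = x \<omega> $ i * w \<omega> $ j" if "\<omega> \<in> space M" for \<omega>
    using carrier_vecD[OF xc[OF that]] carrier_vecD[OF wc[OF that]] ij by simp
  have "integrable M (\<lambda>\<omega>. x \<omega> $ i * w \<omega> $ j)"
    using normal_vec_square_integrable[OF x ij(1)] normal_vec_square_integrable[OF w ij(2)]
    by (intro integrable_mult_square_integrable)
  moreover have "mean_mat M m n (\<lambda>\<omega>. outer_prod (x \<omega>) (w \<omega>)) $$ (i, j) = (\<integral>\<omega>. x \<omega> $ i * w \<omega> $ j \<partial>M)"
    using ij eq by (simp add: mean_mat_def cong: Bochner_Integration.integral_cong)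
  ultimately show "has_bochner_integral M (\<lambda>\<omega>. x \<omega> $ i * w \<omega> $ j)
      (mean_mat M m n (\<lambda>\<omega>. outer_prod (x \<omega>) (w \<omega>)) $$ (i, j))"
    by (simp add: has_bochner_integral_iff)
qed

text \<open>The rows of the constant block vanish because \<open>w\<close> is centred, the remaining
  rows because \<open>x\<close> and \<open>w\<close> are uncorrelated.\<close>

lemma outer_prod_append_const_uncorrelated:
  assumes a: "a \<in> carrier_vec k" and xc: "\<And>\<omega>. \<omega> \<in> space M \<Longrightarrow> x \<omega> \<in> carrier_vec m"
    and wc: "\<And>\<omega>. \<omega> \<in> space M \<Longrightarrow> w \<omega> \<in> carrier_vec n"
    and mean: "\<And>j. j < n \<Longrightarrow> has_bochner_integral M (\<lambda>\<omega>. w \<omega> $ j) 0"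
    and xw: "has_mean_mat M m n (\<lambda>\<omega>. outer_prod (x \<omega>) (w \<omega>)) (0\<^sub>m m n)"
  shows "has_mean_mat M (k + m) n (\<lambda>\<omega>. outer_prod (a @\<^sub>v x \<omega>) (w \<omega>)) (0\<^sub>m (k + m) n)"
proof (rule has_mean_matI)
  show "outer_prod (a @\<^sub>v x \<omega>) (w \<omega>) \<in> carrier_mat (k + m) n" if "\<omega> \<in> space M" for \<omega>
    using a xc[OF that] wc[OF that] by simp
  fix i j assume ij: "i < k + m" "j < n"
  show "outer_prod (a @\<^sub>v x \<omega>) (w \<omega>) $$ (i, j)
      = (if i < k then a $ i * w \<omega> $ j else outer_prod (x \<omega>) (w \<omega>) $$ (i - k, j))"
    if "\<omega> \<in> space M" for \<omega>
    using a carrier_vecD[OF xc[OF that]] carrier_vecD[OF wc[OF that]] ij by simp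
  show "has_bochner_integral M
      (\<lambda>\<omega>. if i < k then a $ i * w \<omega> $ j else outer_prod (x \<omega>) (w \<omega>) $$ (i - k, j))
      (0\<^sub>m (k + m) n $$ (i, j))"
    using has_bochner_integral_mult_right[OF mean[OF ij(2)], of "a $ i"]
      has_mean_matD(3)[OF xw, of "i - k" j] ij
    by (cases "i < k") simp_all
qed simp

text \<open>The first augmented coordinate is a constant, undisturbed by the dynamics and the noise. This
  makes the second moment matrix nonzero and hence the objective genuinely quadratic.\<close>

lemma augmented_second_moment_00:
  assumes n: "0 < n" and D': "D' \<in> carrier_mat ((N + 2) * n) k"
    and D'0: "\<And>c. c < k \<Longrightarrow> D' $$ (0, c) = 0"
    and S: "S \<in> carrier_mat (2 * n) (2 * n)"
  shows "(augmented_state_mat N n A * S * (augmented_state_mat N n A)\<^sup>T + D' * D'\<^sup>T) $$ (0, 0)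
    = S $$ (0, 0)"
proof -
  let ?A = "augmented_state_mat N n A" and ?p = "(N + 2) * n"
  have A: "?A \<in> carrier_mat ?p (2 * n)" by (rule augmented_state_mat_carrier)
  have p: "0 < ?p" using n by simp
  \<comment> \<open>Row 0 lies in the identity block of the augmented matrix, so the congruence
    merely reads off the corner entry of \<open>S\<close>.\<close>
  have "row ?A 0 = unit_vec (2 * n) 0"
  proof (rule eq_vecI)
    fix j assume j: "j < dim_vec (unit_vec (2 * n) 0 :: real vec)"
    have d: "dim_row (stacked_state_mat N n A) = (N + 1) * n" "dim_col (stacked_state_mat N n A) = n"
      using stacked_state_mat_carrier[of N n A] by auto
    have "?A $$ (0, j) = (if j = 0 then 1 else 0)"
      using n j d unfolding augmented_state_mat_def diag_block_mat_pair
      by (subst index_mat_four_block) auto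
    then show "row ?A 0 $ j = unit_vec (2 * n) 0 $ j"
      using A p n j by simp
  qed (use A in simp)
  note r = this
  have AS: "?A * S \<in> carrier_mat ?p (2 * n)" using A S by simp
  have "(?A * S * ?A\<^sup>T) $$ (0, 0) = row (?A * S) 0 \<bullet> unit_vec (2 * n) 0"
    using A AS p by (simp only: r index_mult_mat(1) col_transpose carrier_matD index_transpose_mat)
  also have "\<dots> = row (?A * S) 0 $ 0"
    using AS n by (intro scalar_prod_right_unit[of _ "2 * n"]) auto
  also have "\<dots> = (?A * S) $$ (0, 0)"
    using AS n p by (intro index_row) auto
  also have "\<dots> = unit_vec (2 * n) 0 \<bullet> col S 0"
    using A S n p by (simp only: r index_mult_mat(1) carrier_matD)
  also have "\<dots> = col S 0 $ 0"
    using S n by (intro scalar_prod_left_unit[of _ "2 * n"]) (auto intro!: carrier_vecI)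
  also have "\<dots> = S $$ (0, 0)"
    using S n by (intro index_col) auto
  finally have "(?A * S * ?A\<^sup>T) $$ (0, 0) = S $$ (0, 0)" .
  moreover have "(D' * D'\<^sup>T) $$ (0, 0) = 0"
    using D' D'0 p by (auto simp: scalar_prod_def intro!: sum.neutral)
  ultimately show ?thesis using A S D' p by simp
qed

theorem proposition3:
  fixes N nx nu nw :: nat
    and A B D Q R :: "nat \<Rightarrow> real mat"
    and M :: "'a measure"
    and x0 W X U X0 :: "'a \<Rightarrow> real vec"
    and \<mu>0 \<mu>0' :: "real vec"
    and \<Sigma>0 \<Sigma>0' AA BB DD Qbar Rbar QQ L1 LX L K :: "real mat"
    and J' :: "real mat \<Rightarrow> real"
  assumes dims: "0 < N" "0 < nx" "0 < nu" "0 < nw"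
    and A: "\<And>k. k < N \<Longrightarrow> A k \<in> carrier_mat nx nx"
    and B: "\<And>k. k < N \<Longrightarrow> B k \<in> carrier_mat nx nu"
    and D: "\<And>k. k < N \<Longrightarrow> D k \<in> carrier_mat nx nw"
    and Q: "\<And>k. k < N \<Longrightarrow> psd_mat nx (Q k)"
    and R: "\<And>k. k < N \<Longrightarrow> pd_mat nu (R k)"
    and AA: "AA = augmented_state_mat N nx A"
    and BB: "BB = augmented_input_mat N nx nu A B"
    and DD: "DD = augmented_input_mat N nx nw A D"
    and Qbar: "Qbar = state_weight N nx Q"
    and Rbar: "Rbar = input_weight N R"
    and QQ: "QQ = diag_block_mat [0\<^sub>m nx nx, Qbar]"
    and M: "prob_space M"
    and x0: "normal_vec M nx x0 \<mu>0 \<Sigma>0"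
    and W: "gaussian_vec M (N * nw) W"
    and W_mean: "mean_vec M (N * nw) W = 0\<^sub>v (N * nw)"
    and W_second_moment:
      "mean_mat M (N * nw) (N * nw) (\<lambda>\<omega>. outer_prod (W \<omega>) (W \<omega>)) = 1\<^sub>m (N * nw)"
    and x0_W_uncorrelated:
      "mean_mat M nx (N * nw) (\<lambda>\<omega>. outer_prod (x0 \<omega>) (W \<omega>)) = 0\<^sub>m nx (N * nw)"
    and L1: "L1 \<in> carrier_mat (N * nu) nx"
    and LX: "LX \<in> carrier_mat (N * nu) ((N + 1) * nx)" "block_lower_triangular nu nx LX"
    and L: "L = append_cols L1 LX"
    and K: "K = L * the (mat_inverse (1\<^sub>m ((N + 2) * nx) - BB * L))"
    and X0: "\<And>\<omega>. X0 \<omega> = ones_vec nx @\<^sub>v x0 \<omega>"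
    and \<mu>0': "\<mu>0' = ones_vec nx @\<^sub>v \<mu>0"
    and \<Sigma>0': "\<Sigma>0' = diag_block_mat [0\<^sub>m nx nx, \<Sigma>0]"
    and X: "\<And>\<omega>. \<omega> \<in> space M \<Longrightarrow>
      ones_vec nx @\<^sub>v X \<omega> = (1\<^sub>m ((N + 2) * nx) + BB * K) *\<^sub>v (AA *\<^sub>v X0 \<omega> + DD *\<^sub>v W \<omega>)"
    and U: "\<And>\<omega>. \<omega> \<in> space M \<Longrightarrow> U \<omega> = K *\<^sub>v (AA *\<^sub>v X0 \<omega> + DD *\<^sub>v W \<omega>)"
    and J': "\<And>G. J' G = mat_trace
      (((1\<^sub>m ((N + 2) * nx) + BB * G)\<^sup>T * QQ * (1\<^sub>m ((N + 2) * nx) + BB * G) + G\<^sup>T * Rbar * G)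
       * (AA * (outer_prod \<mu>0' \<mu>0' + \<Sigma>0') * AA\<^sup>T + DD * DD\<^sup>T))"
  shows "mean_vec M (2 * nx) X0 = \<mu>0' \<and> covariance_mat M (2 * nx) X0 = \<Sigma>0' \<and> psd_mat (2 * nx) \<Sigma>0'
    \<and> integrable M (\<lambda>\<omega>. X \<omega> \<bullet> (Qbar *\<^sub>v X \<omega>) + U \<omega> \<bullet> (Rbar *\<^sub>v U \<omega>))
    \<and> (\<integral>\<omega>. X \<omega> \<bullet> (Qbar *\<^sub>v X \<omega>) + U \<omega> \<bullet> (Rbar *\<^sub>v U \<omega>) \<partial>M) = J' K
    \<and> quadratic_in_entries (N * nu) ((N + 2) * nx) J'"
proof -
  let ?p = "(N + 2) * nx" and ?m = "N * nu"
  have AAc: "AA \<in> carrier_mat ?p (2 * nx)" unfolding AA by (rule augmented_state_mat_carrier)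
  have BBc: "BB \<in> carrier_mat ?p ?m" unfolding BB by (rule augmented_input_mat_carrier)
  have DDc: "DD \<in> carrier_mat ?p (N * nw)" unfolding DD by (rule augmented_input_mat_carrier)
  have Lc: "L \<in> carrier_mat ?m ?p"
    using append_cols_carrier[OF L1 LX(1)] unfolding L by (simp add: algebra_simps)
  have "1\<^sub>m ?p - BB * L \<in> carrier_mat ?p ?p" using BBc Lc by auto
  moreover have "det (1\<^sub>m ?p - BB * L) \<noteq> 0"
    unfolding BB L closed_loop_det[OF L1 LX] by simp
  ultimately have Kc: "K \<in> carrier_mat ?m ?p"
    unfolding K using Lc by (intro mult_carrier_mat[OF Lc] mat_inverse_carrier)
  have psd_Qbar: "psd_mat ((N + 1) * nx) Qbar" unfolding Qbar by (rule state_weight_psd[OF Q])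
  then have Qbarc: "Qbar \<in> carrier_mat ((N + 1) * nx) ((N + 1) * nx)" by (simp add: psd_mat_def)
  have QQ_eq: "QQ = four_block_mat (0\<^sub>m nx nx) (0\<^sub>m nx ((N + 1) * nx)) (0\<^sub>m ((N + 1) * nx) nx) Qbar"
    unfolding QQ diag_block_mat_pair carrier_matD[OF Qbarc] by simp
  have p: "nx + (N + 1) * nx = ?p" by simp
  have psd_QQ: "psd_mat ?p QQ"
    using psd_mat_four_block[OF psd_mat_zero[of nx] psd_Qbar] unfolding QQ_eq p .
  then have QQc: "QQ \<in> carrier_mat ?p ?p" by (simp add: psd_mat_def)
  have "psd_mat ?m Rbar" unfolding Rbar by (rule input_weight_psd[OF R])
  then have Rbarc: "Rbar \<in> carrier_mat ?m ?m" by (simp add: psd_mat_def)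

  have \<mu>0c: "\<mu>0 \<in> carrier_vec nx" and psd_\<Sigma>0: "psd_mat nx \<Sigma>0"
    using x0 by (simp_all add: normal_vec_def)
  then have \<Sigma>0c: "\<Sigma>0 \<in> carrier_mat nx nx" by (simp add: psd_mat_def)
  obtain \<nu> \<Theta> where Wn: "normal_vec M (N * nw) W \<nu> \<Theta>"
    using W unfolding gaussian_vec_def by blast
  have x0c: "x0 \<omega> \<in> carrier_vec nx" and Wc: "W \<omega> \<in> carrier_vec (N * nw)" if "\<omega> \<in> space M" for \<omega>
    using x0 Wn that unfolding normal_vec_def random_vec_def by blast+
  have ones: "ones_vec nx \<in> carrier_vec nx" by (simp add: ones_vec_def)
  \<comment> \<open>\<open>W_mean\<close> is an equation between integrals only. Normality supplies
    integrability with some mean \<open>\<nu>\<close>, and the equation then identifies its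
    coordinates as 0.\<close>
  have W0: "has_bochner_integral M (\<lambda>\<omega>. W \<omega> $ j) 0" if j: "j < N * nw" for j
  proof -
    have "mean_vec M (N * nw) W $ j = \<nu> $ j"
      using j has_bochner_integral_integral_eq[OF normal_vec_mean[OF Wn j]] by (simp add: mean_vec_def)
    then show ?thesis using normal_vec_mean[OF Wn j] j unfolding W_mean by simp
  qed
  have n2: "2 * nx = nx + nx" by simp
  have \<Sigma>0'_eq: "\<Sigma>0' = four_block_mat (0\<^sub>m nx nx) (0\<^sub>m nx nx) (0\<^sub>m nx nx) \<Sigma>0"
    unfolding \<Sigma>0' diag_block_mat_pair carrier_matD[OF \<Sigma>0c] by simp
  have psd_\<Sigma>0': "psd_mat (2 * nx) \<Sigma>0'"
    using psd_mat_four_block[OF psd_mat_zero[of nx] psd_\<Sigma>0] unfolding \<Sigma>0'_eq n2 .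
  then have \<Sigma>0'c: "\<Sigma>0' \<in> carrier_mat (2 * nx) (2 * nx)" by (simp add: psd_mat_def)
  have \<mu>0'c: "\<mu>0' \<in> carrier_vec (2 * nx)"
    unfolding \<mu>0' n2 by (rule append_carrier_vec[OF ones \<mu>0c])
  have X0c: "X0 \<omega> \<in> carrier_vec (2 * nx)" if "\<omega> \<in> space M" for \<omega>
    unfolding X0 n2 by (rule append_carrier_vec[OF ones x0c[OF that]])
  have X0_mean: "has_bochner_integral M (\<lambda>\<omega>. X0 \<omega> $ i) (\<mu>0' $ i)" if "i < 2 * nx" for i
    using mean_append_const[OF M ones x0c \<mu>0c normal_vec_mean[OF x0]] that
    unfolding X0 \<mu>0' n2 by blast
  define \<Xi> where "\<Xi> = outer_prod \<mu>0' \<mu>0' + \<Sigma>0'"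
  have \<Xi>c: "\<Xi> \<in> carrier_mat (2 * nx) (2 * nx)" using \<Sigma>0'c by (simp add: \<Xi>_def)
  have XX: "has_mean_mat M (2 * nx) (2 * nx) (\<lambda>\<omega>. outer_prod (X0 \<omega>) (X0 \<omega>)) \<Xi>"
    using outer_prod_append_const[OF M ones x0c \<mu>0c normal_vec_mean[OF x0] \<Sigma>0c
        normal_vec_outer_prod[OF x0]]
    unfolding \<Xi>_def X0 \<mu>0' \<Sigma>0'_eq n2 by blast
  have XW: "has_mean_mat M (2 * nx) (N * nw) (\<lambda>\<omega>. outer_prod (X0 \<omega>) (W \<omega>)) (0\<^sub>m (2 * nx) (N * nw))"
    using outer_prod_append_const_uncorrelated[OF ones x0c Wc W0
        has_mean_mat_normal_outer_prod[OF x0 Wn, unfolded x0_W_uncorrelated]]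
    unfolding X0 n2 by blast
  have WW: "has_mean_mat M (N * nw) (N * nw) (\<lambda>\<omega>. outer_prod (W \<omega>) (W \<omega>)) (1\<^sub>m (N * nw))"
    by (rule has_mean_mat_normal_outer_prod[OF Wn Wn, unfolded W_second_moment])

  \<comment> \<open>State and input are both linear images of \<open>z\<close>. Its second moment
    \<open>S\<close> does not involve the gain, so \<open>K\<close> enters the expected cost through
    \<open>H\<close> alone.\<close>
  define z where "z \<omega> = AA *\<^sub>v X0 \<omega> + DD *\<^sub>v W \<omega>" for \<omega>
  define S where "S = AA * \<Xi> * AA\<^sup>T + DD * DD\<^sup>T"
  have zc: "z \<omega> \<in> carrier_vec ?p" if "\<omega> \<in> space M" for \<omega>
    using AAc DDc X0c[OF that] Wc[OF that] unfolding z_def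
    by (intro add_carrier_vec mult_mat_vec_carrier)
  have Sc: "S \<in> carrier_mat ?p ?p" using AAc DDc \<Xi>c unfolding S_def by auto
  have zz: "has_mean_mat M ?p ?p (\<lambda>\<omega>. outer_prod (z \<omega>) (z \<omega>)) S"
    unfolding z_def S_def by (rule second_moment_linear_combination[OF AAc DDc X0c Wc XX XW WW])
  define F where "F = 1\<^sub>m ?p + BB * K"
  have Fc: "F \<in> carrier_mat ?p ?p" using BBc Kc by (auto simp: F_def)
  define H where "H = F\<^sup>T * QQ * F + K\<^sup>T * Rbar * K"
  have FQFc: "F\<^sup>T * QQ * F \<in> carrier_mat ?p ?p" and KRKc: "K\<^sup>T * Rbar * K \<in> carrier_mat ?p ?p"
    using Fc QQc Kc Rbarc by auto
  then have Hc: "H \<in> carrier_mat ?p ?p" by (simp add: H_def)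
  have cost: "X \<omega> \<bullet> (Qbar *\<^sub>v X \<omega>) + U \<omega> \<bullet> (Rbar *\<^sub>v U \<omega>) = z \<omega> \<bullet> (H *\<^sub>v z \<omega>)"
    if \<omega>: "\<omega> \<in> space M" for \<omega>
  proof -
    have XF: "ones_vec nx @\<^sub>v X \<omega> = F *\<^sub>v z \<omega>" and UK: "U \<omega> = K *\<^sub>v z \<omega>"
      using X[OF \<omega>] U[OF \<omega>] by (simp_all add: F_def z_def)
    \<comment> \<open>The dimension of \<open>X\<close> is read off its defining equation, by
      removing the \<open>nx\<close> rows of ones.\<close>
    have "nx + dim_vec (X \<omega>) = ?p"
      using arg_cong[OF XF, of dim_vec] Fc by (simp add: ones_vec_def)
    then have Xc: "X \<omega> \<in> carrier_vec ((N + 1) * nx)"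
      by (intro carrier_vecI) simp
    have zero: "0\<^sub>m nx nx *\<^sub>v ones_vec nx = 0\<^sub>v nx"
      by (intro eq_vecI) (auto simp: ones_vec_def scalar_prod_def)
    have "X \<omega> \<bullet> (Qbar *\<^sub>v X \<omega>) = (ones_vec nx @\<^sub>v X \<omega>) \<bullet> (QQ *\<^sub>v (ones_vec nx @\<^sub>v X \<omega>))"
      unfolding QQ_eq mult_mat_vec_split[OF zero_carrier_mat Qbarc ones Xc]
      using ones Xc Qbarc zero by (subst scalar_prod_append[of _ nx _ "(N + 1) * nx"]) auto
    also have "\<dots> = z \<omega> \<bullet> (F\<^sup>T * QQ * F *\<^sub>v z \<omega>)"
      unfolding XF by (rule quadratic_form_congruence[OF Fc QQc zc[OF \<omega>]])
    moreover have "U \<omega> \<bullet> (Rbar *\<^sub>v U \<omega>) = z \<omega> \<bullet> (K\<^sup>T * Rbar * K *\<^sub>v z \<omega>)"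
      unfolding UK by (rule quadratic_form_congruence[OF Kc Rbarc zc[OF \<omega>]])
    moreover have "z \<omega> \<bullet> (H *\<^sub>v z \<omega>) = z \<omega> \<bullet> (F\<^sup>T * QQ * F *\<^sub>v z \<omega>) + z \<omega> \<bullet> (K\<^sup>T * Rbar * K *\<^sub>v z \<omega>)"
      unfolding H_def add_mult_distrib_mat_vec[OF FQFc KRKc zc[OF \<omega>]]
      using FQFc KRKc zc[OF \<omega>] by (intro scalar_prod_add_distrib[of _ ?p])
        (auto intro!: mult_mat_vec_carrier)
    ultimately show ?thesis by simp
  qed
  have J'K: "J' K = mat_trace (H * S)"
    unfolding J' H_def F_def S_def \<Xi>_def ..
  have objective: "has_bochner_integral M (\<lambda>\<omega>. X \<omega> \<bullet> (Qbar *\<^sub>v X \<omega>) + U \<omega> \<bullet> (Rbar *\<^sub>v U \<omega>)) (J' K)"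
    unfolding J'K
  proof (rule has_bochner_integral_cong[OF refl _ refl, THEN iffD2])
    show "has_bochner_integral M (\<lambda>\<omega>. z \<omega> \<bullet> (H *\<^sub>v z \<omega>)) (mat_trace (H * S))"
      by (rule quadratic_form_expectation[OF Hc zc zz])
  qed (rule cost)

  have pos: "0 < ?m" "0 < ?p" using dims by simp_all
  \<comment> \<open>The state weight contributes a nonnegative amount; strictness comes from the
    corner entry of \<open>R 0\<close>, which is the first diagonal block of
    \<open>Rbar\<close>.\<close>
  have "0 \<le> (BB\<^sup>T * QQ * BB) $$ (0, 0)"
    by (rule psd_mat_congruence_diag_nonneg[OF psd_QQ BBc pos(1)])
  moreover have "0 < Rbar $$ (0, 0)"
  proof -
    have "R 0 \<in> carrier_mat nu nu" using R[OF dims(1)] by (simp add: pd_mat_def)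
    then show ?thesis
      unfolding Rbar using pd_mat_diag_pos[OF R[OF dims(1)] dims(3)] input_weight_index_0[of N nu R] dims(1,3)
      by simp
  qed
  ultimately have "(BB\<^sup>T * QQ * BB + Rbar) $$ (0, 0) > 0"
    using Rbarc pos(1) by simp
  moreover have "S $$ (0, 0) = 1"
  proof -
    have "DD $$ (0, c) = 0" if "c < N * nw" for c
      unfolding DD using that pos(2) dims(2) by (subst index_augmented_input_mat) auto
    then have "S $$ (0, 0) = \<Xi> $$ (0, 0)"
      unfolding S_def AA by (rule augmented_second_moment_00[OF dims(2) DDc _ \<Xi>c])
    \<comment> \<open>The corner is the square of the first entry of the ones vector, plus an entry
      of the zero block of the covariance.\<close>
    also have "\<dots> = 1"
      using dims(2) \<mu>0c \<Sigma>0c by (simp add: \<Xi>_def \<mu>0' \<Sigma>0'_eq ones_vec_def)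
    finally show ?thesis .
  qed
  ultimately have "(BB\<^sup>T * QQ * BB + Rbar) $$ (0, 0) * S $$ (0, 0) \<noteq> 0" by simp
  \<comment> \<open>Here \<open>J'\<close> is a polynomial on the whole space of matrices of this
    size, not only on gains of the form \<open>L\<close> times the inverse of
    \<open>I - BB * L\<close>; the matrix unit is a legitimate test point for that reason.\<close>
  then have "quadratic_in_entries ?m ?p J'"
    using quadratic_in_entries_trace[OF BBc QQc Rbarc Sc pos]
    unfolding J'[abs_def] S_def \<Xi>_def by blast
  moreover have "mean_vec M (2 * nx) X0 = \<mu>0'" "covariance_mat M (2 * nx) X0 = \<Sigma>0'"
    using covariance_mat_eq[OF M X0c \<mu>0'c X0_mean \<Sigma>0'c XX[unfolded \<Xi>_def]] by blast+
  ultimately show ?thesis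
    using psd_\<Sigma>0' objective by (simp add: has_bochner_integral_iff)
qed

end
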